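(* For each fixed $\varepsilon>0$ and fixed $p$ with $0<p<1$ the following holds. If $r=r(n)$ satisfies $nr^2 \ge n^\varepsilon$, then with probability tending to $1$ as $n\to\infty$, the graph $G=G(n,r,p)$ satisfies \[ \chi(G) = \Theta\left( \frac{nr^2}{\log_{1/(1-p)}(nr^2)}\right), \] where $\chi(G)$ is the chromatic number of $G$.
   Context: The random graph $G(n,r,p)$ is defined as follows. Place $n$ points independently and uniformly at random in the unit torus $[0,1]^2$ (opposite sides identified), and join two points by an edge if their distance in the torus metric is at most $r$; this is the random geometric graph $G(n,r)$. Independently, let $G(n,p)$ be the Erdős–Rényi random graph on the same $n$ vertices, where each pair is an edge independently with probability $p$. Then $G(n,r,p)=G(n,r)\cap G(n,p)$. The $\Theta$ means bounded above and below by positive constant multiples (constants not depending on $n$).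
   Formalization: The formal statement adds that r(n) is nonnegative and bounded, r = O(1): for unbounded r (e.g. r = n) the claim fails, since χ(G) ≤ n while nr²/log(nr²) is of order n³/log n. *)

theory Defs
  imports "HOL-Probability.Probability" "HOL-Library.Landau_Symbols"
begin

type_synonym 'a sgraph = "'a set \<times> 'a set set"

definition proper_colouring :: "'a sgraph \<Rightarrow> nat \<Rightarrow> ('a \<Rightarrow> nat) \<Rightarrow> bool" where
  "proper_colouring G k f \<longleftrightarrow>
     f ` fst G \<subseteq> {..<k} \<and> (\<forall>u\<in>fst G. \<forall>v\<in>fst G. {u, v} \<in> snd G \<longrightarrow> f u \<noteq> f v)"

definition chromatic_number :: "'a sgraph \<Rightarrow> nat" where
  "chromatic_number G = (LEAST k. \<exists>f. proper_colouring G k f)"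

definition all_edges :: "nat \<Rightarrow> nat set set" where
  "all_edges n = {e. e \<subseteq> {..<n} \<and> card e = 2}"

text \<open>The torus is the plane modulo integer translations; this is the quotient metric,
  evaluated on representatives.\<close>

definition torus_dist :: "real \<times> real \<Rightarrow> real \<times> real \<Rightarrow> real" where
  "torus_dist x y = (INF k\<in>\<int> \<times> \<int>. dist x (y + k))"

definition geometric_edges :: "nat \<Rightarrow> real \<Rightarrow> (nat \<Rightarrow> real \<times> real) \<Rightarrow> nat set set" where
  "geometric_edges n r x =
     {{i, j} | i j. i < n \<and> j < n \<and> i \<noteq> j \<and> torus_dist (x i) (x j) \<le> r}"

definition erdos_renyi_edges :: "nat \<Rightarrow> (nat set \<Rightarrow> bool) \<Rightarrow> nat set set" where
  "erdos_renyi_edges n b = {e \<in> all_edges n. b e}"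

text \<open>A sample point \<open>(x, b)\<close> consists of the positions \<open>x i\<close> of the \<open>n\<close> vertices and the
  independent indicators \<open>b e\<close> of the pairs \<open>e\<close> retained by the Erdos--Renyi graph.\<close>

definition sample_space ::
  "nat \<Rightarrow> real \<Rightarrow> ((nat \<Rightarrow> real \<times> real) \<times> (nat set \<Rightarrow> bool)) measure" where
  "sample_space n p =
     (\<Pi>\<^sub>M i\<in>{..<n}. uniform_measure lborel ({0..1} \<times> {0..1}))
       \<Otimes>\<^sub>M (\<Pi>\<^sub>M e\<in>all_edges n. measure_pmf (bernoulli_pmf p))"

definition random_graph ::
  "nat \<Rightarrow> real \<Rightarrow> (nat \<Rightarrow> real \<times> real) \<times> (nat set \<Rightarrow> bool) \<Rightarrow> nat sgraph" where
  "random_graph n r = (\<lambda>(x, b). ({..<n}, geometric_edges n r x \<inter> erdos_renyi_edges n b))"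

lemma prob_space_sample_space: "prob_space (sample_space n p)"
proof -
  have "emeasure lborel ({0..1} \<times> {0..1} :: (real \<times> real) set) = 1"
    by (simp add: lborel_prod[symmetric] lborel.emeasure_pair_measure_Times)
  then have "prob_space (uniform_measure lborel ({0..1} \<times> {0..1} :: (real \<times> real) set))"
    by (intro prob_space_uniform_measure) auto
  then have A: "prob_space (\<Pi>\<^sub>M i\<in>{..<n}. uniform_measure lborel ({0..1} \<times> {0..1} :: (real \<times> real) set))"
    by (intro prob_space_PiM)
  have B: "prob_space (\<Pi>\<^sub>M e\<in>all_edges n. measure_pmf (bernoulli_pmf p))"
    by (intro prob_space_PiM prob_space_measure_pmf)
  show ?thesis
    unfolding sample_space_def by (rule prob_space_pair[OF A B])
qed

lemma torus_dist_unit_square: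
  assumes "fst x \<in> {0..1}" "snd x \<in> {0..1}" "fst y \<in> {0..1}" "snd y \<in> {0..1}"
  defines "d \<equiv> \<lambda>s t :: real. min \<bar>s - t\<bar> (1 - \<bar>s - t\<bar>)"
  shows "torus_dist x y = sqrt ((d (fst x) (fst y))\<^sup>2 + (d (snd x) (snd y))\<^sup>2)"
proof -
  have le: "0 \<le> d s t \<and> d s t \<le> \<bar>s - (t + k)\<bar>"
    if "s \<in> {0..1}" "t \<in> {0..1}" "k \<in> \<int>" for s t k
  proof -
    from \<open>k \<in> \<int>\<close> obtain z where z: "k = of_int z" by (auto elim: Ints_cases)
    consider "z = 0" | "z \<ge> 1" | "z \<le> -1" by linarith
    then show ?thesis
    proof cases
      case 2
      then have "k \<ge> 1" using z by simp
      then show ?thesis using that by (auto simp: d_def min_def abs_if)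
    next
      case 3
      then have "k \<le> -1" using z by (metis of_int_le_iff of_int_minus of_int_1)
      then show ?thesis using that by (auto simp: d_def min_def abs_if)
    qed (use that z in \<open>auto simp: d_def\<close>)
  qed
  have ex: "\<exists>k\<in>\<int>. \<bar>s - (t + k)\<bar> = d s t"
    if "s \<in> {0..1}" "t \<in> {0..1}" for s t
  proof -
    consider "d s t = \<bar>s - t\<bar>" | "d s t = 1 - \<bar>s - t\<bar>" unfolding d_def min_def by presburger
    then show ?thesis
    proof cases
      case 1
      then show ?thesis by (intro bexI[of _ 0]) auto
    next
      case 2
      then show ?thesis using that
        by (intro bexI[of _ "if s \<le> t then -1 else 1"]) (auto simp: abs_if)
    qed
  qed
  obtain k l where kl: "k \<in> \<int>" "l \<in> \<int>" "\<bar>fst x - (fst y + k)\<bar> = d (fst x) (fst y)"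
    "\<bar>snd x - (snd y + l)\<bar> = d (snd x) (snd y)"
    using ex assms(1-4) by metis
  have "dist x (y + (k, l)) = sqrt ((d (fst x) (fst y))\<^sup>2 + (d (snd x) (snd y))\<^sup>2)"
    by (simp add: dist_prod_def dist_real_def flip: kl(3,4))
  moreover have "sqrt ((d (fst x) (fst y))\<^sup>2 + (d (snd x) (snd y))\<^sup>2) \<le> dist x (y + m)"
    if "m \<in> \<int> \<times> \<int>" for m
  proof -
    have "(d (fst x) (fst y))\<^sup>2 \<le> \<bar>fst x - (fst y + fst m)\<bar>\<^sup>2"
      "(d (snd x) (snd y))\<^sup>2 \<le> \<bar>snd x - (snd y + snd m)\<bar>\<^sup>2"
      using le[of "fst x" "fst y" "fst m"] le[of "snd x" "snd y" "snd m"] assms(1-4) that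
      by (intro power_mono; force simp: mem_Times_iff)+
    then show ?thesis by (simp add: dist_prod_def dist_real_def)
  qed
  ultimately show ?thesis
    unfolding torus_dist_def using kl(1,2)
    by (intro cInf_eq_minimum) (auto intro!: image_eqI[of _ _ "(k, l)"])
qed

end

theory Submission
  imports Defs "HOL-Real_Asymp.Real_Asymp"
begin

text \<open>
  Write \<open>N = n r\<^sup>2\<close>. The hypothesis \<open>N \<ge> n\<^sup>\<epsilon>\<close> makes \<open>log n\<close> and \<open>log N\<close> comparable, so it suffices to
  control the two sources of randomness separately: with high probability every vertex set of size
  at least \<open>t = O(log n)\<close> spans a positive proportion of edges and of non-edges of the
  Erdos--Renyi graph, and every cell of a grid of side \<open>\<Theta>(r)\<close> contains fewer than \<open>9 N\<close> points.
  Both follow from exponential moments and a union bound.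

  Lower bound: if cells have diameter at most \<open>r\<close>, then the points of one colour in one cell are
  independent in the Erdos--Renyi graph, hence fewer than \<open>t\<close>. Since there are
  \<open>O(r\<^sup>-\<^sup>2)\<close> cells, \<open>n = O(r\<^sup>-\<^sup>2 \<chi> t)\<close>.

  Upper bound: a positive proportion of non-edges in all large sets yields, by repeatedly passing to the
  non-neighbours of a suitable vertex, an independent set of size of order \<open>log N\<close> in
  every set of about \<open>sqrt N\<close> vertices. Removing such sets one by one colours each cell with
  \<open>O(N / log N)\<close> colours, and cells of equal parity in both coordinates can share their colours.
\<close>

subsection \<open>Exponential moments and measurability\<close>

lemma real_choose_two: "real (n choose 2) = real n * (real n - 1) / 2"
  by (induction n) (simp_all add: numeral_2_eq_2 field_simps)

text \<open>Moment generating function of a binomial variable: the coordinates are independent, so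
  the integral factors over \<open>I\<close>, each index in \<open>J\<close> contributing the same
  one-point integral and each index outside \<open>J\<close> the total mass 1.\<close>

lemma nn_integral_exp_count:
  assumes "prob_space M" "finite I" "J \<subseteq> I" "A \<in> sets M"
  shows "(\<integral>\<^sup>+x. ennreal (exp (\<theta> * real (card {i\<in>J. x i \<in> A}))) \<partial>(\<Pi>\<^sub>M i\<in>I. M))
           = ennreal ((1 + measure M A * (exp \<theta> - 1)) ^ card J)"
proof -
  interpret M: prob_space M by fact
  interpret product_prob_space "\<lambda>_. M" I by unfold_locales
  have fin: "finite J" using assms finite_subset by blast
  define g where "g = (\<lambda>z. if z \<in> A then exp \<theta> else 1)"
  have [measurable]: "A \<in> sets M" by fact
  have gM[measurable]: "g \<in> borel_measurable M" unfolding g_def by measurable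
  have g0: "g z \<ge> 0" for z by (simp add: g_def)
  have "(\<integral>\<^sup>+z. ennreal (g z) \<partial>M) = ennreal (\<integral>z. g z \<partial>M)"
    by (rule nn_integral_eq_integral, rule M.integrable_const_bound[of _ "exp \<theta> + 1"])
       (auto simp: g_def less_imp_le)
  also have "(\<integral>z. g z \<partial>M) = (\<integral>z. 1 + (exp \<theta> - 1) * indicator A z \<partial>M)"
    by (rule Bochner_Integration.integral_cong) (auto simp: g_def)
  also have "\<dots> = 1 + measure M A * (exp \<theta> - 1)"
    by (subst Bochner_Integration.integral_add)
       (auto simp: M.prob_space intro!: M.integrable_const_bound[of _ "1 + \<bar>exp \<theta> - 1\<bar>"] split: split_indicator)
  finally have one: "(\<integral>\<^sup>+z. ennreal (g z) \<partial>M) = ennreal (1 + measure M A * (exp \<theta> - 1))" .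
  \<comment> \<open>For negative \<theta> the summand with \<open>exp \<theta> - 1\<close> is
    negative, so positivity comes from reading the expression as a convex combination of 1 and
    \<open>exp \<theta>\<close>.\<close>
  have nonneg: "0 \<le> 1 + measure M A * (exp \<theta> - 1)"
  proof -
    have "1 + measure M A * (exp \<theta> - 1) = (1 - measure M A) + measure M A * exp \<theta>"
      by (simp add: algebra_simps)
    also have "\<dots> \<ge> 0" using M.prob_le_1[of A] by (intro add_nonneg_nonneg) auto
    finally show ?thesis .
  qed
  have "ennreal (exp (\<theta> * real (card {i\<in>J. x i \<in> A})))
          = (\<Prod>i\<in>I. if i \<in> J then ennreal (g (x i)) else 1)" for x
  proof -
    have "(\<Prod>i\<in>I. if i \<in> J then ennreal (g (x i)) else 1) = (\<Prod>i\<in>J. ennreal (g (x i)))"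
      using assms by (intro prod.mono_neutral_cong_right) auto
    also have "\<dots> = ennreal (\<Prod>i\<in>J. g (x i))" by (simp add: prod_ennreal g0)
    also have "(\<Prod>i\<in>J. g (x i)) = (\<Prod>i\<in>J. if x i \<in> A then exp \<theta> else 1)" by (simp add: g_def)
    also have "\<dots> = (\<Prod>i\<in>{i\<in>J. x i \<in> A}. exp \<theta>)" by (rule prod.inter_filter[OF fin, symmetric])
    also have "\<dots> = exp (\<theta> * real (card {i\<in>J. x i \<in> A}))" by (simp add: exp_of_nat2_mult)
    finally show ?thesis by simp
  qed
  then have "(\<integral>\<^sup>+x. ennreal (exp (\<theta> * real (card {i\<in>J. x i \<in> A}))) \<partial>(\<Pi>\<^sub>M i\<in>I. M))
      = (\<integral>\<^sup>+x. (\<Prod>i\<in>I. (\<lambda>z. if i \<in> J then ennreal (g z) else 1) (x i)) \<partial>(\<Pi>\<^sub>M i\<in>I. M))"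
    by simp
  also have "\<dots> = (\<Prod>i\<in>I. \<integral>\<^sup>+z. (if i \<in> J then ennreal (g z) else 1) \<partial>M)"
    by (rule product_nn_integral_prod) (use assms in auto)
  also have "\<dots> = (\<Prod>i\<in>J. \<integral>\<^sup>+z. ennreal (g z) \<partial>M)"
    using assms by (intro prod.mono_neutral_cong_right) (auto simp: M.emeasure_space_1)
  also have "\<dots> = ennreal ((1 + measure M A * (exp \<theta> - 1)) ^ card J)"
    using nonneg by (simp add: one ennreal_power)
  finally show ?thesis .
qed

lemma measurable_card_PiM:
  assumes "finite J" "J \<subseteq> I" "A \<in> sets M"
  shows "(\<lambda>x. real (card {i\<in>J. x i \<in> A})) \<in> borel_measurable (\<Pi>\<^sub>M i\<in>I. M)"
proof -
  have "(\<lambda>x. real (card {i\<in>J. x i \<in> A})) = (\<lambda>x. \<Sum>i\<in>J. indicator A (x i))"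
  proof
    fix x
    have "real (card {i\<in>J. x i \<in> A}) = (\<Sum>i\<in>{i\<in>J. x i \<in> A}. 1)" by simp
    also have "\<dots> = (\<Sum>i\<in>J. if x i \<in> A then 1 else 0)" using assms by (subst sum.inter_filter) auto
    finally show "real (card {i\<in>J. x i \<in> A}) = (\<Sum>i\<in>J. indicator A (x i))"
      by (simp add: indicator_def of_bool_def)
  qed
  moreover have "\<dots> \<in> borel_measurable (\<Pi>\<^sub>M i\<in>I. M)"
  proof (rule borel_measurable_sum)
    fix i assume "i \<in> J"
    then have "i \<in> I" using assms by auto
    from measurable_component_singleton[OF this, of "\<lambda>_. M"] assms(3)
    show "(\<lambda>x. indicator A (x i) :: real) \<in> borel_measurable (\<Pi>\<^sub>M i\<in>I. M)"
      by measurable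
  qed
  ultimately show ?thesis by simp
qed

text \<open>Chernoff bound: Markov's inequality for the exponential moment, followed by
  \<open>1 + x \<le> exp x\<close>. The factor \<theta> is kept on both sides of the event so that
  one statement covers both tails: \<theta> = 1 bounds the points in a cell from above, \<theta> =
  -1 bounds the number of pairs of a given kind from below.\<close>

lemma prob_count_le:
  assumes "prob_space M" "finite I" "J \<subseteq> I" "A \<in> sets M"
  shows "measure (\<Pi>\<^sub>M i\<in>I. M) {x \<in> space (\<Pi>\<^sub>M i\<in>I. M). \<theta> * y \<le> \<theta> * real (card {i\<in>J. x i \<in> A})}
           \<le> exp (measure M A * (exp \<theta> - 1) * real (card J) - \<theta> * y)"
proof -
  interpret M: prob_space M by fact
  interpret P: prob_space "\<Pi>\<^sub>M i\<in>I. M" by (rule prob_space_PiM) (rule assms)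
  let ?P = "\<Pi>\<^sub>M i\<in>I. M" and ?c = "\<lambda>x. real (card {i\<in>J. x i \<in> A})"
  have [measurable]: "?c \<in> borel_measurable ?P"
    using assms finite_subset by (intro measurable_card_PiM) blast+
  have "emeasure ?P {x \<in> space ?P. 1 \<le> ennreal (exp (- \<theta> * y)) * ennreal (exp (\<theta> * ?c x))}
      \<le> ennreal (exp (- \<theta> * y)) * (\<integral>\<^sup>+x. ennreal (exp (\<theta> * ?c x)) * indicator (space ?P) x \<partial>?P)"
    by (rule nn_integral_Markov_inequality) auto
  also have "(\<integral>\<^sup>+x. ennreal (exp (\<theta> * ?c x)) * indicator (space ?P) x \<partial>?P) = (\<integral>\<^sup>+x. ennreal (exp (\<theta> * ?c x)) \<partial>?P)"
    by (rule nn_integral_cong) auto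
  also have "\<dots> = ennreal ((1 + measure M A * (exp \<theta> - 1)) ^ card J)"
    by (rule nn_integral_exp_count) fact+
  also have "\<dots> \<le> ennreal (exp (measure M A * (exp \<theta> - 1)) ^ card J)"
  proof (intro ennreal_leI power_mono)
    show "1 + measure M A * (exp \<theta> - 1) \<le> exp (measure M A * (exp \<theta> - 1))" by simp
    have "1 + measure M A * (exp \<theta> - 1) = (1 - measure M A) + measure M A * exp \<theta>"
      by (simp add: algebra_simps)
    also have "\<dots> \<ge> 0" using M.prob_le_1[of A] by (intro add_nonneg_nonneg) auto
    finally show "0 \<le> 1 + measure M A * (exp \<theta> - 1)" .
  qed
  also have "ennreal (exp (- \<theta> * y)) * \<dots> = ennreal (exp (measure M A * (exp \<theta> - 1) * real (card J) - \<theta> * y))"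
    by (subst ennreal_mult[symmetric])
       (auto simp: exp_of_nat_mult[symmetric] exp_add[symmetric] algebra_simps)
  also have "{x \<in> space ?P. 1 \<le> ennreal (exp (- \<theta> * y)) * ennreal (exp (\<theta> * ?c x))}
      = {x \<in> space ?P. \<theta> * y \<le> \<theta> * ?c x}"
    by (simp add: ennreal_mult[symmetric] exp_add[symmetric] flip: ennreal_1)
  finally show ?thesis by (simp add: P.emeasure_eq_measure mult_left_mono)
qed

section \<open>Measurability of the chromatic number\<close>

lemma measurable_torus_dist: "(\<lambda>z. torus_dist (fst z) (snd z)) \<in> borel_measurable (borel \<Otimes>\<^sub>M borel)"
proof -
  \<comment> \<open>Only countably many translations occur, so the infimum of measurable functions,
    all bounded below by 0, is measurable.\<close>
  have c: "countable ((\<int> :: real set) \<times> (\<int> :: real set))"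
    by (intro countable_SIGMA) (auto simp: Ints_def)
  have [measurable]: "(\<lambda>z. dist (fst z) (snd z + k)) \<in> borel_measurable (borel \<Otimes>\<^sub>M borel)"
    for k :: "real \<times> real"
    by measurable
  show ?thesis unfolding torus_dist_def
    by (rule borel_measurable_cINF[OF c]) (auto intro!: bdd_belowI2[of _ 0])
qed

lemma finite_all_edges: "finite (all_edges n)"
  unfolding all_edges_def by (rule finite_subset[of _ "Pow {..<n}"]) auto

text \<open>The chromatic number is a function of the edge set, which takes values in the finite set
  \<open>Pow (all_edges n)\<close>. It is therefore enough that for each single pair the event of
  being an edge is measurable.\<close>

lemma measurable_chromatic_number:
  "(\<lambda>\<omega>. chromatic_number (random_graph n r \<omega>)) \<in> sample_space n p \<rightarrow>\<^sub>M count_space UNIV"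
proof -
  let ?S = "sample_space n p"
  let ?E = "\<lambda>\<omega>. geometric_edges n r (fst \<omega>) \<inter> erdos_renyi_edges n (snd \<omega>)"
  have x[measurable]: "(\<lambda>\<omega>. fst \<omega> i) \<in> ?S \<rightarrow>\<^sub>M borel" if "i < n" for i
  proof -
    have "(\<lambda>x. x i) \<in> (\<Pi>\<^sub>M i\<in>{..<n}. uniform_measure lborel ({0..1} \<times> {0..1} :: (real\<times>real) set)) \<rightarrow>\<^sub>M
       uniform_measure lborel ({0..1} \<times> {0..1} :: (real\<times>real) set)"
      using that by (intro measurable_component_singleton) auto
    then have "(\<lambda>x. x i) \<in> (\<Pi>\<^sub>M i\<in>{..<n}. uniform_measure lborel ({0..1} \<times> {0..1} :: (real\<times>real) set)) \<rightarrow>\<^sub>M borel"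
      by (simp cong: measurable_cong_sets)
    then show ?thesis unfolding sample_space_def by measurable
  qed
  have b[measurable]: "Measurable.pred ?S (\<lambda>\<omega>. snd \<omega> e)" if "e \<in> all_edges n" for e
  proof -
    have "(\<lambda>b. b e) \<in> (\<Pi>\<^sub>M e\<in>all_edges n. measure_pmf (bernoulli_pmf p)) \<rightarrow>\<^sub>M measure_pmf (bernoulli_pmf p)"
      using that by (intro measurable_component_singleton) auto
    then have "(\<lambda>b. b e) \<in> (\<Pi>\<^sub>M e\<in>all_edges n. measure_pmf (bernoulli_pmf p)) \<rightarrow>\<^sub>M count_space UNIV"
      by (simp cong: measurable_cong_sets)
    then show ?thesis unfolding sample_space_def by measurable
  qed
  have t[measurable]: "(\<lambda>\<omega>. torus_dist (fst \<omega> i) (fst \<omega> j)) \<in> borel_measurable ?S" if "i < n" "j < n" for i j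
    using measurable_compose[OF measurable_Pair[OF x[OF that(1)] x[OF that(2)]] measurable_torus_dist]
    by simp
  have eE: "Measurable.pred ?S (\<lambda>\<omega>. e \<in> ?E \<omega>)" if "e \<in> all_edges n" for e
  proof -
    from that obtain i j where ij: "e = {i, j}" "i \<noteq> j" "i < n" "j < n"
      unfolding all_edges_def by (auto simp: card_2_iff)
    \<comment> \<open>An unordered pair can be listed in either order in
      \<open>geometric_edges\<close>; keeping both distances avoids an appeal to the symmetry of
      \<open>torus_dist\<close>.\<close>
    have "e \<in> ?E \<omega> \<longleftrightarrow> (torus_dist (fst \<omega> i) (fst \<omega> j) \<le> r \<or> torus_dist (fst \<omega> j) (fst \<omega> i) \<le> r) \<and> snd \<omega> e" for \<omega>
      using ij that unfolding geometric_edges_def erdos_renyi_edges_def by (auto simp: doubleton_eq_iff)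
    moreover have "Measurable.pred ?S (\<lambda>\<omega>. (torus_dist (fst \<omega> i) (fst \<omega> j) \<le> r \<or> torus_dist (fst \<omega> j) (fst \<omega> i) \<le> r) \<and> snd \<omega> e)"
      using ij(3,4) that by measurable
    ultimately show ?thesis by simp
  qed
  have sub: "?E \<omega> \<in> Pow (all_edges n)" for \<omega> unfolding erdos_renyi_edges_def by auto
  have "?E \<in> ?S \<rightarrow>\<^sub>M count_space (Pow (all_edges n))"
  proof (subst measurable_count_space_eq2, simp add: finite_all_edges, intro conjI ballI)
    show "?E \<in> space ?S \<rightarrow> Pow (all_edges n)" using sub by blast
    fix F assume F: "F \<in> Pow (all_edges n)"
    have "?E -` {F} \<inter> space ?S = {\<omega> \<in> space ?S. \<forall>e\<in>all_edges n. e \<in> ?E \<omega> \<longleftrightarrow> e \<in> F}"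
      using sub F by blast
    also have "\<dots> \<in> sets ?S"
    proof (rule sets.sets_Collect_finite_All[OF _ finite_all_edges])
      fix e assume "e \<in> all_edges n"
      from eE[OF this] have "Measurable.pred ?S (\<lambda>\<omega>. (e \<in> ?E \<omega>) \<longleftrightarrow> (e \<in> F))" by measurable
      then show "{\<omega> \<in> space ?S. (e \<in> ?E \<omega>) = (e \<in> F)} \<in> sets ?S" by measurable
    qed
    finally show "?E -` {F} \<inter> space ?S \<in> sets ?S" .
  qed
  from measurable_compose[OF this, of "\<lambda>F. chromatic_number ({..<n}, F)" "count_space UNIV"]
  show ?thesis by (simp add: random_graph_def case_prod_unfold)
qed

subsection \<open>Exceptional sets\<close>

lemma sum_power_card_Pow:
  fixes z :: "'a :: comm_semiring_1"
  assumes "finite A"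
  shows "(\<Sum>U\<in>Pow A. z ^ card U) = (1 + z) ^ card A"
  using prod_add[OF assms, of "\<lambda>_. z" "\<lambda>_. 1"] by (simp add: add.commute)

text \<open>The set \<open>E\<close> collects the outcomes where some large \<open>U\<close> has too
  few pairs with some value \<beta>. Every pair takes either value with probability at least
  \<open>a\<close>, so for fixed \<open>U\<close> and \<beta> this is a lower-tail event. Its
  exponent is quadratic in \<open>card U\<close>, and the hypothesis on \<open>t0\<close> lets it
  beat \<open>2 * card U * ln n\<close>, which makes the union bound over all \<open>U\<close>
  converge.\<close>

lemma exceptional_set_pairs:
  fixes a p :: real and n t0 :: nat
  defines "B \<equiv> (\<Pi>\<^sub>M e\<in>all_edges n. measure_pmf (bernoulli_pmf p))"
  assumes p: "0 < p" "p < 1" "a = min p (1 - p)" and n: "1 \<le> n" "1 \<le> t0"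
    and t0: "16 * ln (real n) \<le> a * (real t0 - 1)"
  obtains E where "E \<in> sets B" "measure B E \<le> 2 * (exp (1 / real n) - 1)"
    "\<And>b U \<beta>. b \<in> space B - E \<Longrightarrow> U \<subseteq> {..<n} \<Longrightarrow> t0 \<le> card U \<Longrightarrow>
       a / 4 * real (card U choose 2) < real (card {e. e \<subseteq> U \<and> card e = 2 \<and> b e = \<beta>})"
proof -
  let ?M = "measure_pmf (bernoulli_pmf p)"
  interpret B: prob_space B unfolding B_def by (intro prob_space_PiM prob_space_measure_pmf)
  define y where "y = (\<lambda>U :: nat set. a / 4 * real (card U choose 2))"
  define J where "J = (\<lambda>U :: nat set. {e. e \<subseteq> U \<and> card e = 2})"
  \<comment> \<open>The factors -1 match \<theta> = -1 in \<open>prob_count_le\<close>.\<close>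
  define E1 where "E1 = (\<lambda>(U, \<beta>). {b \<in> space B. (-1) * y U \<le> (-1) * real (card {e\<in>J U. b e \<in> {\<beta>}})})"
  define F where "F = {U. U \<subseteq> {..<n} \<and> t0 \<le> card U}"
  have F: "finite F" unfolding F_def by (rule finite_subset[of _ "Pow {..<n}"]) auto
  have a: "0 < a" using p by simp
  have J: "J U \<subseteq> all_edges n" "finite (J U)" "card (J U) = card U choose 2" if "U \<in> F" for U
  proof -
    have "finite U" using that finite_subset by (auto simp: F_def)
    then show "card (J U) = card U choose 2" unfolding J_def by (rule n_subsets)
    show "J U \<subseteq> all_edges n" using that by (auto simp: J_def all_edges_def F_def)
    then show "finite (J U)" using finite_all_edges finite_subset by blast
  qed
  have E1: "E1 (U, \<beta>) \<in> sets B" if "U \<in> F" for U \<beta>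
    unfolding E1_def prod.case
    using measurable_card_PiM[OF J(2,1)[OF that], of "{\<beta>}" ?M, folded B_def] by measurable
  have pE1: "measure B (E1 (U, \<beta>)) \<le> (1 / real n ^ 2) ^ card U" if "U \<in> F" for U \<beta>
  proof -
    have "measure B (E1 (U, \<beta>)) \<le> exp (measure ?M {\<beta>} * (exp (-1) - 1) * real (card (J U)) - (-1) * y U)"
      unfolding E1_def prod.case B_def
      by (rule prob_count_le[OF prob_space_measure_pmf finite_all_edges J(1)[OF that]]) simp
    also have "\<dots> \<le> exp (- 2 * ln (real n) * real (card U))"
    proof (subst exp_le_cancel_iff)
      define M where "M = real (card U choose 2)"
      define u where "u = real (card U)"
      have u: "u \<ge> real t0" using that by (simp add: F_def u_def)
      have M: "M = u * (u - 1) / 2" unfolding M_def u_def by (rule real_choose_two)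
      \<comment> \<open>Since \<open>1 - exp (-1)\<close> is at least 1/2, the mean contributes at
        most \<open>- a * M / 2\<close> to the exponent, and the threshold gives back
        \<open>a * M / 4\<close>. The remaining \<open>a * M / 4 = a * u * (u - 1) / 8\<close> is at
        least \<open>2 * u * ln n\<close> by the choice of \<open>t0\<close>.\<close>
      have "exp (-1) \<le> (1/2 :: real)" using exp_ge_add_one_self[of 1] by (simp add: exp_minus field_simps)
      moreover have "a \<le> measure ?M {\<beta>}" using p by (cases \<beta>) (auto simp: measure_pmf_single)
      ultimately have "a * (1/2) \<le> measure ?M {\<beta>} * (1 - exp (-1))" using a by (intro mult_mono) auto
      then have "a * (1/2) * M \<le> measure ?M {\<beta>} * (1 - exp (-1)) * M" by (rule mult_right_mono) (simp add: M_def)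
      then have "measure ?M {\<beta>} * (exp (-1) - 1) * M \<le> - a / 2 * M" by (simp add: algebra_simps)
      then have "measure ?M {\<beta>} * (exp (-1) - 1) * M - (-1) * y U \<le> - (a / 4 * M)"
        unfolding y_def M_def[symmetric] by linarith
      also have "\<dots> = - (u * (a * (u - 1)) / 8)" by (simp add: M)
      also have "\<dots> \<le> - (u * (16 * ln (real n)) / 8)"
      proof -
        have "16 * ln (real n) \<le> a * (u - 1)"
          using t0 a u mult_left_mono[of "real t0 - 1" "u - 1" a] by linarith
        then have "u * (16 * ln (real n)) \<le> u * (a * (u - 1))" by (rule mult_left_mono) (simp add: u_def)
        then show ?thesis by simp
      qed
      finally show "measure ?M {\<beta>} * (exp (-1) - 1) * real (card (J U)) - (-1) * y U \<le> - 2 * ln (real n) * real (card U)"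
        using J(3)[OF that] by (simp add: M_def u_def mult_ac)
    qed
    also have "\<dots> = exp (- 2 * ln (real n)) ^ card U" by (rule exp_of_nat2_mult)
    also have "exp (- 2 * ln (real n)) = 1 / real n ^ 2"
      using n by (simp add: exp_minus exp_double inverse_eq_divide)
    finally show ?thesis .
  qed
  show thesis
  proof
    let ?E = "\<Union>i\<in>F \<times> UNIV. E1 i"
    show "?E \<in> sets B" using F E1 by (intro sets.finite_UN) (auto simp: finite_cartesian_product)
    have "measure B ?E \<le> (\<Sum>i\<in>F \<times> UNIV. measure B (E1 i))"
      using F E1 by (intro B.finite_measure_subadditive_finite) (auto simp: finite_cartesian_product)
    also have "\<dots> \<le> (\<Sum>i\<in>F \<times> (UNIV :: bool set). (1 / real n ^ 2) ^ card (fst i))"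
      using pE1 by (intro sum_mono) auto
    also have "\<dots> = (\<Sum>U\<in>F. \<Sum>\<beta>\<in>(UNIV :: bool set). (1 / real n ^ 2) ^ card U)"
      by (subst sum.cartesian_product) (simp add: case_prod_unfold)
    also have "\<dots> = 2 * (\<Sum>U\<in>F. (1 / real n ^ 2) ^ card U)" by (simp add: sum_distrib_left UNIV_bool)
    \<comment> \<open>Enlarging to all nonempty sets gives a binomial sum. The empty set may be left
      out because \<open>t0\<close> is at least 1, and only the resulting \<open>- 1\<close> makes
      the bound small.\<close>
    also have "(\<Sum>U\<in>F. (1 / real n ^ 2) ^ card U) \<le> (\<Sum>U\<in>Pow {..<n} - {{}}. (1 / real n ^ 2) ^ card U)"
      using n by (intro sum_mono2) (auto simp: F_def)
    also have "\<dots> = (\<Sum>U\<in>Pow {..<n}. (1 / real n ^ 2) ^ card U) - 1" by (simp add: sum_diff1)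
    also have "\<dots> = (1 + 1 / real n ^ 2) ^ n - 1" by (subst sum_power_card_Pow) auto
    also have "\<dots> \<le> exp (1 / real n ^ 2) ^ n - 1"
      by (intro diff_right_mono power_mono exp_ge_add_one_self) auto
    also have "exp (1 / real n ^ 2) ^ n = exp (1 / real n)"
      using n by (simp add: exp_of_nat_mult[symmetric] power2_eq_square)
    finally show "measure B ?E \<le> 2 * (exp (1 / real n) - 1)" by simp
    fix b U \<beta> assume *: "b \<in> space B - ?E" "U \<subseteq> {..<n}" "t0 \<le> card U"
    then have "b \<notin> E1 (U, \<beta>)" by (auto simp: F_def)
    then show "a / 4 * real (card U choose 2) < real (card {e. e \<subseteq> U \<and> card e = 2 \<and> b e = \<beta>})"
      using * by (simp add: E1_def y_def J_def conj_assoc)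
  qed
qed

section \<open>Number of points in the grid cells\<close>

definition torus_cell :: "nat \<Rightarrow> nat \<times> nat \<Rightarrow> (real \<times> real) set" where
  "torus_cell L c = {real (fst c) / L..(real (fst c) + 1) / L} \<times> {real (snd c) / L..(real (snd c) + 1) / L}"

lemma prob_space_unit_square: "prob_space (uniform_measure lborel ({0..1} \<times> {0..1} :: (real \<times> real) set))"
proof -
  have "emeasure lborel ({0..1} \<times> {0..1} :: (real \<times> real) set) = 1"
    by (simp add: lborel_prod[symmetric] lborel.emeasure_pair_measure_Times)
  then show ?thesis by (intro prob_space_uniform_measure) auto
qed

lemma emeasure_unit_square_Times:
  assumes "X \<in> sets borel" "Y \<in> sets borel" "X \<subseteq> {0..1}" "Y \<subseteq> {0..1}"
  shows "emeasure (uniform_measure lborel ({0..1} \<times> {0..1} :: (real \<times> real) set)) (X \<times> Y)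
    = emeasure lborel X * emeasure lborel Y"
proof -
  have "emeasure lborel ({0..1} \<times> {0..1} :: (real \<times> real) set) = 1"
    by (simp add: lborel_prod[symmetric] lborel.emeasure_pair_measure_Times)
  moreover have "({0..1} \<times> {0..1}) \<inter> X \<times> Y = X \<times> Y" using assms by auto
  moreover have "X \<times> Y \<in> sets (borel :: (real \<times> real) measure)"
    unfolding borel_prod[symmetric] using assms by auto
  moreover have "emeasure lborel (X \<times> Y) = emeasure lborel X * emeasure lborel Y"
    using assms by (simp add: lborel_prod[symmetric] lborel.emeasure_pair_measure_Times)
  moreover have "({0..1} \<times> {0..1} :: (real \<times> real) set) \<in> sets borel"
    by (intro borel_closed closed_Times closed_atLeastAtMost)
  ultimately show ?thesis by (subst emeasure_uniform_measure) (simp_all add: divide_ennreal_def)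
qed

text \<open>A cell has area \<open>1 / L^2\<close>, so its expected number of points is at most
  \<open>4 * N\<close>. With \<theta> = 1 and \<open>exp 1 - 1 \<le> 2\<close>, the Chernoff
  exponent for reaching \<open>9 * N\<close> points is at most \<open>8 * N - 9 * N = - N\<close>;
  the factor \<open>L^2\<close> is the union bound over the cells.\<close>

lemma exceptional_set_points:
  fixes N :: real and n L :: nat
  defines "A \<equiv> (\<Pi>\<^sub>M i\<in>{..<n}. uniform_measure lborel ({0..1} \<times> {0..1} :: (real \<times> real) set))"
  assumes L: "1 \<le> L" "real n / real L ^ 2 \<le> 4 * N"
  obtains E where "E \<in> sets A" "measure A E \<le> real L ^ 2 * exp (- N)"
    "\<And>x i. x \<in> space A - E \<Longrightarrow> i < n \<Longrightarrow> x i \<in> {0..<1} \<times> {0..<1}"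
    "\<And>x c. x \<in> space A - E \<Longrightarrow> c \<in> {..<L} \<times> {..<L} \<Longrightarrow> real (card {i\<in>{..<n}. x i \<in> torus_cell L c}) < 9 * N"
proof -
  let ?M = "uniform_measure lborel ({0..1} \<times> {0..1} :: (real \<times> real) set)"
  interpret M: prob_space ?M by (rule prob_space_unit_square)
  interpret A: prob_space A unfolding A_def by (intro prob_space_PiM prob_space_unit_square)
  \<comment> \<open>Points with a coordinate equal to 1 form a null event, which joins the
    exceptional set: for them a floor index could reach \<open>L\<close>.\<close>
  have "emeasure ?M ({0..<1} \<times> {0..<1}) = 1" by (subst emeasure_unit_square_Times) auto
  then have "AE z in ?M. z \<in> {0..<1} \<times> {0..<1}" by (intro M.AE_prob_1) (simp add: measure_def)
  then have "AE x in A. \<forall>i\<in>{..<n}. x i \<in> {0..<1} \<times> {0..<1}"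
    unfolding A_def using prob_space_unit_square
    by (subst AE_finite_all) (auto intro!: AE_PiM_component)
  then obtain N0 where N0: "N0 \<in> null_sets A"
    "{x \<in> space A. \<not> (\<forall>i\<in>{..<n}. x i \<in> {0..<1} \<times> {0..<1})} \<subseteq> N0"
    unfolding eventually_ae_filter by blast
  define E1 where "E1 = (\<lambda>c. {x \<in> space A. 1 * (9 * N) \<le> 1 * real (card {i\<in>{..<n}. x i \<in> torus_cell L c})})"
  have cell: "torus_cell L c \<in> sets borel" for c
    unfolding torus_cell_def borel_prod[symmetric] by auto
  have E1: "E1 c \<in> sets A" for c
    unfolding E1_def A_def using measurable_card_PiM[of "{..<n}" "{..<n}" "torus_cell L c" ?M] cell by measurable
  have pE1: "measure A (E1 c) \<le> exp (- N)" if "c \<in> {..<L} \<times> {..<L}" for c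
  proof -
    have "{real i / real L..(real i + 1) / real L} \<subseteq> {0..1}" if "i < L" for i
      using that by (auto simp: field_simps intro: order_trans)
    then have "emeasure ?M (torus_cell L c) = ennreal (1 / real L) * ennreal (1 / real L)"
      using that unfolding torus_cell_def
      by (subst emeasure_unit_square_Times) (auto simp: divide_right_mono diff_divide_distrib[symmetric])
    then have "measure ?M (torus_cell L c) = 1 / real L ^ 2"
      by (simp add: measure_def ennreal_mult[symmetric] power2_eq_square)
    moreover have "measure A (E1 c) \<le> exp (measure ?M (torus_cell L c) * (exp 1 - 1) * real (card {..<n}) - 1 * (9 * N))"
      unfolding E1_def A_def by (rule prob_count_le[OF prob_space_unit_square]) (use cell in auto)
    ultimately have "measure A (E1 c) \<le> exp (real n / real L ^ 2 * (exp 1 - 1) - 9 * N)" by (simp add: mult.commute)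
    also have "\<dots> \<le> exp (real n / real L ^ 2 * 2 - 9 * N)"
      using exp_le by (simp add: mult_left_mono divide_right_mono)
    also have "\<dots> \<le> exp (- N)" using mult_right_mono[OF L(2), of 2] by (subst exp_le_cancel_iff) linarith
    finally show ?thesis .
  qed
  show thesis
  proof
    let ?E = "N0 \<union> (\<Union>c\<in>{..<L} \<times> {..<L}. E1 c)"
    have S: "(\<Union>c\<in>{..<L} \<times> {..<L}. E1 c) \<in> sets A" using E1 by (intro sets.finite_UN) auto
    then show "?E \<in> sets A" using N0 by auto
    have "measure A ?E = measure A (\<Union>c\<in>{..<L} \<times> {..<L}. E1 c)"
      using N0(1) S by (metis Un_commute measure_Un_null_set)
    also have "\<dots> \<le> (\<Sum>c\<in>{..<L} \<times> {..<L}. measure A (E1 c))"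
      using E1 by (intro A.finite_measure_subadditive_finite) auto
    also have "\<dots> \<le> (\<Sum>c\<in>{..<L} \<times> {..<L}. exp (- N))" by (intro sum_mono pE1)
    also have "\<dots> = real L ^ 2 * exp (- N)" by (simp add: power2_eq_square)
    finally show "measure A ?E \<le> real L ^ 2 * exp (- N)" .
    show "x i \<in> {0..<1} \<times> {0..<1}" if "x \<in> space A - ?E" "i < n" for x i
      using that N0(2) by blast
    show "real (card {i\<in>{..<n}. x i \<in> torus_cell L c}) < 9 * N"
      if "x \<in> space A - ?E" "c \<in> {..<L} \<times> {..<L}" for x c
      using that by (auto simp: E1_def not_le)
  qed
qed

text \<open>Union bound in the product space: the complement of \<open>G\<close> lies in the two
  cylinders over \<open>E\<close> and \<open>F\<close>. This reduces the remaining argument to a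
  deterministic statement about a good \<open>x\<close> and a good \<open>b\<close>.\<close>

lemma measure_pair_cylinders:
  assumes "prob_space A" "prob_space B" "E \<in> sets A" "F \<in> sets B" "G \<in> sets (A \<Otimes>\<^sub>M B)"
    and "\<And>x b. x \<in> space A - E \<Longrightarrow> b \<in> space B - F \<Longrightarrow> (x, b) \<in> G"
  shows "1 - measure A E - measure B F \<le> measure (A \<Otimes>\<^sub>M B) G"
proof -
  interpret A: prob_space A by fact
  interpret B: prob_space B by fact
  interpret P: pair_prob_space A B by unfold_locales
  have E: "E \<times> space B \<in> sets (A \<Otimes>\<^sub>M B)" "space A \<times> F \<in> sets (A \<Otimes>\<^sub>M B)" using assms by auto
  have mE: "measure (A \<Otimes>\<^sub>M B) (E \<times> space B) = measure A E"
    using assms by (simp add: measure_def B.emeasure_pair_measure_Times B.emeasure_space_1)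
  have mF: "measure (A \<Otimes>\<^sub>M B) (space A \<times> F) = measure B F"
    using assms by (simp add: measure_def B.emeasure_pair_measure_Times A.emeasure_space_1)
  have "1 = measure (A \<Otimes>\<^sub>M B) (space (A \<Otimes>\<^sub>M B))" by (simp add: P.prob_space)
  also have "\<dots> \<le> measure (A \<Otimes>\<^sub>M B) (G \<union> (E \<times> space B \<union> space A \<times> F))"
    using assms E by (intro P.finite_measure_mono) (auto simp: space_pair_measure)
  also have "\<dots> \<le> measure (A \<Otimes>\<^sub>M B) G + measure (A \<Otimes>\<^sub>M B) (E \<times> space B \<union> space A \<times> F)"
    using assms E by (intro measure_Un_le) auto
  also have "measure (A \<Otimes>\<^sub>M B) (E \<times> space B \<union> space A \<times> F) \<le> measure A E + measure B F"
    using measure_Un_le[OF E] by (simp add: mE mF)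
  finally show ?thesis by simp
qed

subsection \<open>Colourings from non-edges\<close>

text \<open>Greedy choice: take a vertex with at least the proportion \<eta> of non-neighbours and
  continue inside them. Each step costs a factor \<eta>, so a start from
  \<open>t / \<eta> ^ j\<close> vertices keeps the current set above the threshold \<open>t\<close>
  for \<open>j\<close> choices. The assumption on singletons is needed because independence is also
  tested at \<open>u = v\<close>.\<close>

lemma indep_set_of_nondegree:
  fixes t \<eta> :: real
  assumes "finite V" "0 < \<eta>" "\<eta> \<le> 1" "0 \<le> t" "\<And>v. {v} \<notin> E"
    and deg: "\<And>U. U \<subseteq> V \<Longrightarrow> t \<le> real (card U) \<Longrightarrow>
                \<exists>v\<in>U. \<eta> * real (card U) \<le> real (card {w\<in>U - {v}. {v, w} \<notin> E})"
    and "U \<subseteq> V" "t / \<eta> ^ j \<le> real (card U)"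
  shows "\<exists>I\<subseteq>U. card I = j \<and> (\<forall>u\<in>I. \<forall>v\<in>I. {u, v} \<notin> E)"
  using assms(7,8)
proof (induction j arbitrary: U)
  case 0
  then show ?case by (intro exI[of _ "{}"]) auto
next
  case (Suc j)
  have "t \<le> t / \<eta> ^ Suc j"
    using assms(2-4) power_le_one[of \<eta> "Suc j"] mult_left_mono[of "\<eta> ^ Suc j" 1 t]
    by (simp add: pos_le_divide_eq del: power_Suc)
  then obtain v where v: "v \<in> U" "\<eta> * real (card U) \<le> real (card {w\<in>U - {v}. {v, w} \<notin> E})"
    using deg[OF Suc.prems(1) order_trans[OF _ Suc.prems(2)]] by blast
  define W where "W = {w\<in>U - {v}. {v, w} \<notin> E}"
  have "t / \<eta> ^ j = \<eta> * (t / \<eta> ^ Suc j)" using assms(2) by simp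
  also have "\<dots> \<le> \<eta> * real (card U)" using Suc.prems assms(2) by (intro mult_left_mono) auto
  finally have "t / \<eta> ^ j \<le> real (card W)" using v by (simp add: W_def)
  moreover have "W \<subseteq> V" using Suc.prems by (auto simp: W_def)
  ultimately obtain I where I: "I \<subseteq> W" "card I = j" "\<forall>u\<in>I. \<forall>v\<in>I. {u, v} \<notin> E"
    using Suc.IH[of W] by blast
  have fin: "finite I" using I(1) \<open>W \<subseteq> V\<close> assms(1) by (meson finite_subset)
  have "v \<notin> I" using I(1) by (auto simp: W_def)
  then have "card (insert v I) = Suc j" using I(2) fin by simp
  moreover have "insert v I \<subseteq> U" using I(1) v(1) by (auto simp: W_def)
  moreover have "\<forall>a\<in>insert v I. \<forall>b\<in>insert v I. {a, b} \<notin> E"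
    using I(1,3) assms(5) by (auto simp: W_def insert_commute)
  ultimately show ?case by blast
qed

text \<open>While at least \<open>T\<close> vertices remain, an independent set of size
  \<open>j\<close> is removed and given a new colour, which happens at most
  \<open>card S / j\<close> times. The fewer than \<open>T\<close> vertices left over get pairwise
  distinct colours.\<close>

lemma colouring_of_indep_sets:
  fixes T :: real
  assumes "finite S" "0 < j" "0 \<le> T" "\<And>v. {v} \<notin> E"
    and ind: "\<And>U. U \<subseteq> S \<Longrightarrow> T \<le> real (card U) \<Longrightarrow> \<exists>I\<subseteq>U. card I = j \<and> (\<forall>u\<in>I. \<forall>v\<in>I. {u, v} \<notin> E)"
  shows "\<exists>k f. proper_colouring (S, E) k f \<and> real k \<le> real (card S) / real j + T"
  using assms(1) ind
proof (induction "card S" arbitrary: S rule: less_induct)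
  case less
  show ?case
  proof (cases "T \<le> real (card S)")
    case True
    then obtain I where I: "I \<subseteq> S" "card I = j" "\<forall>u\<in>I. \<forall>v\<in>I. {u, v} \<notin> E"
      using less.prems(2) by blast
    have finI: "finite I" using finite_subset[OF I(1) less.prems(1)] .
    have cd: "card (S - I) = card S - j" using I finI by (simp add: card_Diff_subset)
    have jle: "j \<le> card S" using card_mono[OF less.prems(1) I(1)] I(2) by simp
    have "card (S - I) < card S" using cd jle assms(2) by simp
    then obtain k f where kf: "proper_colouring (S - I, E) k f" "real k \<le> real (card (S - I)) / real j + T"
      using less.hyps[of "S - I"] less.prems(1) less.prems(2)[OF order_trans[OF _ Diff_subset]] by blast
    have "proper_colouring (S, E) (Suc k) (\<lambda>v. if v \<in> I then k else f v)"
      unfolding proper_colouring_def fst_conv snd_conv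
    proof (intro conjI ballI impI)
      have f: "f v < k" if "v \<in> S" "v \<notin> I" for v
        using kf(1) that by (auto simp: proper_colouring_def)
      then show "(\<lambda>v. if v \<in> I then k else f v) ` S \<subseteq> {..<Suc k}"
        by (auto simp: less_Suc_eq)
      fix u v assume uv: "u \<in> S" "v \<in> S" "{u, v} \<in> E"
      consider "u \<in> I" "v \<in> I" | "u \<in> I" "v \<notin> I" | "u \<notin> I" "v \<in> I" | "u \<notin> I" "v \<notin> I" by blast
      then show "(if u \<in> I then k else f u) \<noteq> (if v \<in> I then k else f v)"
      proof cases
        case 1
        then show ?thesis using I(3) uv by blast
      next
        case 2
        then show ?thesis using f[of v] uv by simp
      next
        case 3
        then show ?thesis using f[of u] uv by simp
      next
        case 4
        then show ?thesis using kf(1) uv by (simp add: proper_colouring_def)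
      qed
    qed
    moreover have "real (Suc k) \<le> real (card S) / real j + T"
      using kf(2) cd jle assms(2) by (simp add: field_simps of_nat_diff)
    ultimately show ?thesis by blast
  next
    case False
    obtain f :: "_ \<Rightarrow> nat" where f: "f ` S = {..<card S}" "inj_on f S"
      using less.prems(1) by (metis bij_betw_def ex_bij_betw_finite_nat atLeast0LessThan)
    have "proper_colouring (S, E) (card S) f"
      unfolding proper_colouring_def fst_conv snd_conv
    proof (intro conjI ballI impI)
      fix u v assume "u \<in> S" "v \<in> S" "{u, v} \<in> E"
      moreover from this have "u \<noteq> v" using assms(4)[of u] by auto
      ultimately show "f u \<noteq> f v" using f(2) by (auto dest: inj_onD)
    qed (use f in auto)
    moreover have "real (card S) \<le> real (card S) / real j + T"
      using False add_increasing[of "real (card S) / real j" "real (card S)" T] by simp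
    ultimately show ?thesis by blast
  qed
qed

section \<open>Handling the minimum in the chromatic number\<close>

lemma chromatic_number_le: "proper_colouring G k f \<Longrightarrow> chromatic_number G \<le> k"
  unfolding chromatic_number_def using Least_le[of "\<lambda>k. \<exists>f. proper_colouring G k f" k] by blast

lemma chromatic_number_colouring:
  assumes "proper_colouring G k f"
  shows "\<exists>f. proper_colouring G (chromatic_number G) f"
  unfolding chromatic_number_def
  using LeastI[of "\<lambda>k. \<exists>f. proper_colouring G k f" k] assms by blast

text \<open>Guarantees that the \<open>LEAST\<close> in \<open>chromatic_number\<close> ranges over
  a nonempty set, so that the lower bound can start from a colouring attaining it.\<close>

lemma ex_proper_colouring_random_graph: "\<exists>k f. proper_colouring (random_graph n r \<omega>) k f"
proof -
  have "proper_colouring (random_graph n r \<omega>) n (\<lambda>v. v)"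
    unfolding proper_colouring_def random_graph_def case_prod_unfold fst_conv snd_conv
  proof (intro conjI ballI impI)
    fix u v assume "{u, v} \<in> geometric_edges n r (fst \<omega>) \<inter> erdos_renyi_edges n (snd \<omega>)"
    then have "card {u, v} = 2" by (simp add: erdos_renyi_edges_def all_edges_def)
    then show "u \<noteq> v" by auto
  qed simp
  then show ?thesis by blast
qed

text \<open>Averaging: each non-edge inside \<open>U\<close> is counted at one of its ends, so if
  all non-degrees were below \<open>a / 4 * card U\<close>, there would be fewer than
  \<open>a * (card U)^2 / 4\<close> non-edges. For at least two vertices this contradicts
  \<open>(card U)^2 / 4 \<le> card U choose 2\<close>.\<close>

lemma ex_large_nondegree:
  fixes a :: real
  assumes "finite U" "2 \<le> card U" "0 < a"
    and many: "a * real (card U choose 2) \<le> real (card {e. e \<subseteq> U \<and> card e = 2 \<and> e \<notin> E})"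
  shows "\<exists>v\<in>U. a / 4 * real (card U) \<le> real (card {w\<in>U - {v}. {v, w} \<notin> E})"
proof (rule ccontr)
  let ?N = "\<lambda>v. {w\<in>U - {v}. {v, w} \<notin> E}"
  assume neg: "\<not> ?thesis"
  have small: "real (card (?N v)) < a / 4 * real (card U)" if "v \<in> U" for v
    using neg that by (meson not_le)
  have "{e. e \<subseteq> U \<and> card e = 2 \<and> e \<notin> E} \<subseteq> (\<Union>v\<in>U. (\<lambda>w. {v, w}) ` ?N v)"
  proof
    fix e assume "e \<in> {e. e \<subseteq> U \<and> card e = 2 \<and> e \<notin> E}"
    then obtain v w where "e = {v, w}" "v \<noteq> w" "v \<in> U" "w \<in> U" "e \<notin> E" by (auto simp: card_2_iff)
    then show "e \<in> (\<Union>v\<in>U. (\<lambda>w. {v, w}) ` ?N v)" by auto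
  qed
  then have "card {e. e \<subseteq> U \<and> card e = 2 \<and> e \<notin> E} \<le> card (\<Union>v\<in>U. (\<lambda>w. {v, w}) ` ?N v)"
    using assms(1) by (intro card_mono) auto
  also have "\<dots> \<le> (\<Sum>v\<in>U. card ((\<lambda>w. {v, w}) ` ?N v))" by (rule card_UN_le) fact
  also have "\<dots> \<le> (\<Sum>v\<in>U. card (?N v))" using assms(1) by (intro sum_mono card_image_le) auto
  finally have "a * real (card U choose 2) \<le> (\<Sum>v\<in>U. real (card (?N v)))"
    using many by (simp flip: of_nat_sum)
  also have "\<dots> < (\<Sum>v\<in>U. a / 4 * real (card U))"
    using assms(1,2) by (intro sum_strict_mono small) auto
  also have "\<dots> = a * (real (card U) ^ 2 / 4)" by (simp add: power2_eq_square)
  also have "\<dots> \<le> a * real (card U choose 2)"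
  proof -
    have "real (card U) * real (card U) \<le> real (card U) * (2 * (real (card U) - 1))"
      using assms(2) by (intro mult_left_mono) auto
    then have "real (card U) ^ 2 / 4 \<le> real (card U choose 2)"
      by (simp add: real_choose_two power2_eq_square mult_ac)
    then show ?thesis using assms(3) by simp
  qed
  finally show False by (rule less_irrefl[THEN notE])
qed

subsection \<open>Cells of the torus\<close>

lemma torus_dist_ge_coordinates:
  assumes "z \<in> {0..<1} \<times> {0..<1}" "w \<in> {0..<1} \<times> {0..<1}"
  shows "min \<bar>fst z - fst w\<bar> (1 - \<bar>fst z - fst w\<bar>) \<le> torus_dist z w"
    and "min \<bar>snd z - snd w\<bar> (1 - \<bar>snd z - snd w\<bar>) \<le> torus_dist z w"
  using assms by (subst torus_dist_unit_square; force intro: real_sqrt_sum_squares_ge1 real_sqrt_sum_squares_ge2)+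

lemma torus_dist_le_coordinates:
  assumes "z \<in> {0..<1} \<times> {0..<1}" "w \<in> {0..<1} \<times> {0..<1}"
  shows "torus_dist z w \<le> \<bar>fst z - fst w\<bar> + \<bar>snd z - snd w\<bar>"
proof -
  let ?d = "\<lambda>s t :: real. min \<bar>s - t\<bar> (1 - \<bar>s - t\<bar>)"
  have d: "\<bar>?d s t\<bar> \<le> \<bar>s - t\<bar>" if "s \<in> {0..<1}" "t \<in> {0..<1}" for s t
    using that by (auto simp: min_def abs_if)
  have "torus_dist z w = sqrt ((?d (fst z) (fst w))\<^sup>2 + (?d (snd z) (snd w))\<^sup>2)"
    using assms by (intro torus_dist_unit_square) auto
  also have "\<dots> \<le> \<bar>?d (fst z) (fst w)\<bar> + \<bar>?d (snd z) (snd w)\<bar>" by (rule sqrt_sum_squares_le_sum_abs)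
  also have "\<dots> \<le> \<bar>fst z - fst w\<bar> + \<bar>snd z - snd w\<bar>" using assms by (intro add_mono d) auto
  finally show ?thesis .
qed

text \<open>The closed cells of \<open>torus_cell\<close> overlap along their boundaries; the floors
  select one of them for each point. On the half-open unit square both indices stay below
  \<open>L\<close>.\<close>

definition cell_index :: "nat \<Rightarrow> real \<times> real \<Rightarrow> nat \<times> nat" where
  "cell_index L z = (nat \<lfloor>real L * fst z\<rfloor>, nat \<lfloor>real L * snd z\<rfloor>)"

lemma nat_floor_mult_unit:
  assumes "1 \<le> L" "0 \<le> t" "t < (1 :: real)"
  shows "nat \<lfloor>real L * t\<rfloor> < L" "real (nat \<lfloor>real L * t\<rfloor>) \<le> real L * t"
    "real L * t < real (nat \<lfloor>real L * t\<rfloor>) + 1"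
proof -
  have "0 \<le> \<lfloor>real L * t\<rfloor>" using assms by simp
  then have eq: "real (nat \<lfloor>real L * t\<rfloor>) = of_int \<lfloor>real L * t\<rfloor>" by simp
  show "real (nat \<lfloor>real L * t\<rfloor>) \<le> real L * t" "real L * t < real (nat \<lfloor>real L * t\<rfloor>) + 1"
    unfolding eq by linarith+
  moreover have "real L * t < real L" using assms by simp
  ultimately show "nat \<lfloor>real L * t\<rfloor> < L" by linarith
qed

lemma cell_index_in:
  assumes "1 \<le> L" "z \<in> {0..<1} \<times> {0..<1}"
  shows "cell_index L z \<in> {..<L} \<times> {..<L}" "z \<in> torus_cell L (cell_index L z)"
  using assms nat_floor_mult_unit[of L "fst z"] nat_floor_mult_unit[of L "snd z"]
  by (auto simp: cell_index_def torus_cell_def field_simps mem_Times_iff less_imp_le)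

text \<open>Each coordinate varies by at most \<open>1 / L\<close> inside a cell, and the distance
  is bounded by the sum of the coordinate differences, hence 2 in place of the square root of
  2.\<close>

lemma torus_dist_same_cell:
  assumes "1 \<le> L" "z \<in> {0..<1} \<times> {0..<1}" "w \<in> {0..<1} \<times> {0..<1}" "cell_index L z = cell_index L w"
  shows "torus_dist z w \<le> 2 / real L"
proof -
  have *: "\<bar>s - t\<bar> \<le> 1 / real L"
    if "s \<in> {0..<1}" "t \<in> {0..<1}" "nat \<lfloor>real L * s\<rfloor> = nat \<lfloor>real L * t\<rfloor>" for s t
  proof -
    have "\<bar>real L * s - real L * t\<bar> \<le> 1"
      using nat_floor_mult_unit(2,3)[OF assms(1), of s, unfolded that(3)]
        nat_floor_mult_unit(2,3)[OF assms(1), of t] that(1,2)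
      unfolding atLeastLessThan_iff by linarith
    also have "\<bar>real L * s - real L * t\<bar> = real L * \<bar>s - t\<bar>"
      by (simp add: abs_mult flip: right_diff_distrib)
    finally show ?thesis using assms(1) by (simp add: field_simps)
  qed
  note index_eq = conjunct1[OF assms(4)[unfolded cell_index_def prod.inject]]
    conjunct2[OF assms(4)[unfolded cell_index_def prod.inject]]
  have "torus_dist z w \<le> \<bar>fst z - fst w\<bar> + \<bar>snd z - snd w\<bar>"
    using assms(2,3) by (intro torus_dist_le_coordinates)
  also have "\<dots> \<le> 1 / real L + 1 / real L"
    using assms(2,3)[unfolded mem_Times_iff]
    by (intro add_mono *[OF _ _ index_eq(1)] *[OF _ _ index_eq(2)]) blast+
  finally show ?thesis by simp
qed

text \<open>The parity of \<open>L\<close> matters for indices on opposite sides of the wrap-around.\<close>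

lemma separated_of_same_parity:
  assumes "even L" "s \<in> {0..<1}" "t \<in> {0..<1}"
    and "nat \<lfloor>real L * s\<rfloor> \<noteq> nat \<lfloor>real L * t\<rfloor>" "nat \<lfloor>real L * s\<rfloor> mod 2 = nat \<lfloor>real L * t\<rfloor> mod 2"
  shows "1 / real L < min \<bar>s - t\<bar> (1 - \<bar>s - t\<bar>)"
proof -
  have *: "1 / real L < min \<bar>s - t\<bar> (1 - \<bar>s - t\<bar>)"
    if st: "s \<in> {0..<1}" "t \<in> {0..<1}" and less: "nat \<lfloor>real L * s\<rfloor> < nat \<lfloor>real L * t\<rfloor>"
      and parity: "nat \<lfloor>real L * s\<rfloor> mod 2 = nat \<lfloor>real L * t\<rfloor> mod 2" for s t
  proof -
    define i where "i = nat \<lfloor>real L * s\<rfloor>"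
    define k where "k = nat \<lfloor>real L * t\<rfloor>"
    have L: "1 \<le> L" using less by (cases "L = 0") auto
    have s: "i < L" "real i \<le> real L * s" "real L * s < real i + 1"
      unfolding i_def using nat_floor_mult_unit[OF L, of s] st by auto
    have t: "k < L" "real k \<le> real L * t" "real L * t < real k + 1"
      unfolding k_def using nat_floor_mult_unit[OF L, of t] st by auto
    have ik: "i < k" "i mod 2 = k mod 2" using less parity unfolding i_def k_def .
    \<comment> \<open>Equal parity excludes an index gap of 1. The gap \<open>L - (k - i)\<close>
      the other way round the torus is positive and even, hence also at least 2. A gap of 2 leaves
      more than one full cell width between the points, because the floors lose less than 1.\<close>
    then have "i + 2 \<le> k" by presburger
    moreover have "k + 2 \<le> L + i" using ik t(1) assms(1) by presburger
    ultimately have "real i + 2 \<le> real k" "real k + 2 \<le> real L + real i" by linarith+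
    then have "1 < real L * (t - s)" "1 < real L * (1 - (t - s))"
      using s t by (auto simp: algebra_simps)
    then have *: "1 / real L < t - s" "1 / real L < 1 - (t - s)"
      using L by (auto simp: divide_less_eq mult.commute)
    have "0 < t - s" by (rule le_less_trans[OF _ *(1)]) simp
    then show ?thesis using * by (simp add: abs_if)
  qed
  consider "nat \<lfloor>real L * s\<rfloor> < nat \<lfloor>real L * t\<rfloor>" | "nat \<lfloor>real L * t\<rfloor> < nat \<lfloor>real L * s\<rfloor>"
    using assms(4) by linarith
  then show ?thesis
  proof cases
    case 1
    then show ?thesis using assms by (intro *)
  next
    case 2
    then have "1 / real L < min \<bar>t - s\<bar> (1 - \<bar>t - s\<bar>)" using assms by (intro *) auto
    then show ?thesis by (simp add: abs_minus_commute)
  qed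
qed

lemma torus_dist_distinct_cells:
  assumes "even L" "z \<in> {0..<1} \<times> {0..<1}" "w \<in> {0..<1} \<times> {0..<1}" "cell_index L z \<noteq> cell_index L w"
    "fst (cell_index L z) mod 2 = fst (cell_index L w) mod 2"
    "snd (cell_index L z) mod 2 = snd (cell_index L w) mod 2"
  shows "1 / real L < torus_dist z w"
proof -
  have mem: "fst z \<in> {0..<1}" "fst w \<in> {0..<1}" "snd z \<in> {0..<1}" "snd w \<in> {0..<1}"
    using assms(2,3) by auto
  consider "nat \<lfloor>real L * fst z\<rfloor> \<noteq> nat \<lfloor>real L * fst w\<rfloor>" | "nat \<lfloor>real L * snd z\<rfloor> \<noteq> nat \<lfloor>real L * snd w\<rfloor>"
    using assms(4) unfolding cell_index_def by blast
  then show ?thesis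
  proof cases
    case 1
    then have "1 / real L < min \<bar>fst z - fst w\<bar> (1 - \<bar>fst z - fst w\<bar>)"
      using assms(5)[unfolded cell_index_def fst_conv]
      by (rule separated_of_same_parity[OF assms(1) mem(1,2)])
    also have "\<dots> \<le> torus_dist z w" by (rule torus_dist_ge_coordinates(1)[OF assms(2,3)])
    finally show ?thesis .
  next
    case 2
    then have "1 / real L < min \<bar>snd z - snd w\<bar> (1 - \<bar>snd z - snd w\<bar>)"
      using assms(6)[unfolded cell_index_def snd_conv]
      by (rule separated_of_same_parity[OF assms(1) mem(3,4)])
    also have "\<dots> \<le> torus_dist z w" by (rule torus_dist_ge_coordinates(2)[OF assms(2,3)])
    finally show ?thesis .
  qed
qed

section \<open>From cells to bounds on the chromatic number\<close>

lemma geometric_edges_iff: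
  assumes "u < n" "v < n"
  shows "{u, v} \<in> geometric_edges n r x \<longleftrightarrow> u \<noteq> v \<and> (torus_dist (x u) (x v) \<le> r \<or> torus_dist (x v) (x u) \<le> r)"
  using assms unfolding geometric_edges_def by (auto simp: doubleton_eq_iff)

lemma parity_digits:
  fixes i j k l :: nat
  assumes "2 * (i mod 2) + j mod 2 = 2 * (k mod 2) + l mod 2"
  shows "i mod 2 = k mod 2" "j mod 2 = l mod 2"
  using assms unfolding mod_2_eq_odd by (auto simp: of_bool_def split: if_splits)

text \<open>A vertex is coloured by the parity class of its cell together with its colour inside
  that cell. Distinct cells of one class are more than \<open>1 / L \<ge> r\<close> apart, so no
  edge joins them, and their palettes may coincide; there are four classes. The case
  \<open>L = 1\<close> covers large \<open>r\<close>, where everything lies in one cell.\<close>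

lemma chromatic_number_le_cells:
  assumes L: "1 \<le> L" "L = 1 \<or> even L \<and> r \<le> 1 / real L"
    and x: "\<And>i. i < n \<Longrightarrow> x i \<in> {0..<1} \<times> {0..<1}"
    and col: "\<And>c. c \<in> {..<L} \<times> {..<L} \<Longrightarrow>
       \<exists>g. proper_colouring ({i\<in>{..<n}. x i \<in> torus_cell L c}, erdos_renyi_edges n b) Q g"
  shows "chromatic_number (random_graph n r (x, b)) \<le> 4 * Q"
proof -
  define c where "c = (\<lambda>i. cell_index L (x i))"
  define S where "S = (\<lambda>d. {i\<in>{..<n}. x i \<in> torus_cell L d})"
  let ?E = "erdos_renyi_edges n b"
  have "\<forall>d\<in>{..<L} \<times> {..<L}. \<exists>g. proper_colouring (S d, ?E) Q g" unfolding S_def by (intro ballI col)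
  from bchoice[OF this] obtain g
    where g: "\<And>d. d \<in> {..<L} \<times> {..<L} \<Longrightarrow> proper_colouring (S d, ?E) Q (g d)" by blast
  have cL: "c i \<in> {..<L} \<times> {..<L}" and cS: "i \<in> S (c i)" if "i < n" for i
    using cell_index_in[OF L(1) x[OF that]] that by (simp_all add: c_def S_def)
  \<comment> \<open>The two parities as a binary number below 4. In the colour
    \<open>k i * Q + g (c i) i\<close> the second summand stays below \<open>Q\<close>, so
    \<open>div Q\<close> recovers the class.\<close>
  define k where "k = (\<lambda>i. 2 * (fst (c i) mod 2) + snd (c i) mod 2)"
  have gQ: "g (c i) i < Q" if "i < n" for i
    using g[OF cL[OF that]] cS[OF that] by (auto simp: proper_colouring_def)
  have k3: "k i \<le> 3" for i
    using mod_less_divisor[of 2 "fst (c i)"] mod_less_divisor[of 2 "snd (c i)"] unfolding k_def by linarith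
  have "proper_colouring (random_graph n r (x, b)) (4 * Q) (\<lambda>i. k i * Q + g (c i) i)"
    unfolding proper_colouring_def random_graph_def prod.case fst_conv snd_conv
  proof (intro conjI ballI impI)
    show "(\<lambda>i. k i * Q + g (c i) i) ` {..<n} \<subseteq> {..<4 * Q}"
    proof (rule image_subsetI)
      fix i assume "i \<in> {..<n}"
      then have "k i * Q + g (c i) i < 3 * Q + Q"
        using gQ[of i] by (intro add_le_less_mono mult_right_mono k3) simp_all
      then show "k i * Q + g (c i) i \<in> {..<4 * Q}" by simp
    qed
    fix u v assume u: "u \<in> {..<n}" and v: "v \<in> {..<n}" and e: "{u, v} \<in> geometric_edges n r x \<inter> ?E"
    show "k u * Q + g (c u) u \<noteq> k v * Q + g (c v) v"
    proof
      assume eq: "k u * Q + g (c u) u = k v * Q + g (c v) v"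
      have gu: "g (c u) u < Q" and gv: "g (c v) v < Q" using u v gQ by auto
      have "(k u * Q + g (c u) u) div Q = k u" "(k v * Q + g (c v) v) div Q = k v"
        using gu gv by auto
      then have kk: "k u = k v" using eq by simp
      then have gg: "g (c u) u = g (c v) v" using eq by simp
      show False
      proof (cases "c u = c v")
        case True
        have "u \<in> S (c u)" "v \<in> S (c u)" using cS u v True by (metis lessThan_iff)+
        then show False using g[OF cL, of u] gg e u True by (auto simp: proper_colouring_def)
      next
        case False
        \<comment> \<open>With a single cell there is no bound on \<open>r\<close> to use, but then
          the two cells could not differ.\<close>
        have "L \<noteq> 1" using cL[of u] cL[of v] u v False by (auto simp: prod_eq_iff)
        then have L2: "even L" "r \<le> 1 / real L" using L(2) by auto
        have k_eq: "2 * (fst (c u) mod 2) + snd (c u) mod 2 = 2 * (fst (c v) mod 2) + snd (c v) mod 2"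
          using kk unfolding k_def .
        have xuv: "x u \<in> {0..<1} \<times> {0..<1}" "x v \<in> {0..<1} \<times> {0..<1}" using x u v by blast+
        have "1 / real L < torus_dist (x u) (x v)"
          using L2(1) xuv False[unfolded c_def] parity_digits[OF k_eq, unfolded c_def]
          by (rule torus_dist_distinct_cells)
        moreover have "1 / real L < torus_dist (x v) (x u)"
          using L2(1) xuv(2,1) False[symmetric, unfolded c_def] parity_digits[OF k_eq[symmetric], unfolded c_def]
          by (rule torus_dist_distinct_cells)
        ultimately have "\<not> torus_dist (x u) (x v) \<le> r" "\<not> torus_dist (x v) (x u) \<le> r" using L2(2) by linarith+
        then show False using e u v L2(2) by (auto simp: geometric_edges_iff)
      qed
    qed
  qed
  then show ?thesis by (rule chromatic_number_le)
qed

text \<open>Pigeonhole over pairs of a cell and a colour. If a class had more than \<open>t\<close>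
  vertices, it would span an Erdos-Renyi edge, and its ends, lying in one cell of diameter at most
  \<open>2 / K \<le> r\<close>, would also be joined in the geometric graph, although they share a
  colour.\<close>

lemma card_le_chromatic_number_cells:
  assumes K: "1 \<le> K" "2 / real K \<le> r"
    and x: "\<And>i. i < n \<Longrightarrow> x i \<in> {0..<1} \<times> {0..<1}"
    and edge: "\<And>U. U \<subseteq> {..<n} \<Longrightarrow> t \<le> card U \<Longrightarrow> \<exists>e\<subseteq>U. card e = 2 \<and> b e"
  shows "n \<le> K ^ 2 * chromatic_number (random_graph n r (x, b)) * t"
proof -
  define ch where "ch = chromatic_number (random_graph n r (x, b))"
  obtain f where f: "proper_colouring (random_graph n r (x, b)) ch f"
    using ex_proper_colouring_random_graph chromatic_number_colouring unfolding ch_def by metis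
  define R where "R = ({..<K} \<times> {..<K}) \<times> {..<ch}"
  define F where "F = (\<lambda>y. {v\<in>{..<n}. (cell_index K (x v), f v) = y})"
  have F_le: "card (F y) \<le> t" for y
  proof (rule ccontr)
    assume "\<not> card (F y) \<le> t"
    then obtain e where e: "e \<subseteq> F y" "card e = 2" "b e"
      using edge[of "F y"] by (auto simp: F_def)
    then obtain u v where uv: "e = {u, v}" "u \<noteq> v" by (auto simp: card_2_iff)
    with e have n: "u < n" "v < n" and *: "cell_index K (x u) = cell_index K (x v)" "f u = f v"
      by (auto simp: F_def)
    have "torus_dist (x u) (x v) \<le> 2 / real K"
      using K x n * by (intro torus_dist_same_cell) auto
    then have "torus_dist (x u) (x v) \<le> r" using K(2) by linarith
    then have "e \<in> geometric_edges n r x \<inter> erdos_renyi_edges n b"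
      using n uv e by (auto simp: geometric_edges_iff erdos_renyi_edges_def all_edges_def)
    then show False using f n * uv by (auto simp: proper_colouring_def random_graph_def)
  qed
  have "{..<n} \<subseteq> (\<Union>y\<in>R. F y)"
  proof
    fix v assume v: "v \<in> {..<n}"
    then have "(cell_index K (x v), f v) \<in> R"
      using cell_index_in(1)[OF K(1) x] f unfolding R_def by (auto simp: proper_colouring_def random_graph_def)
    then show "v \<in> (\<Union>y\<in>R. F y)" using v by (auto simp: F_def)
  qed
  then have "card {..<n} \<le> card (\<Union>y\<in>R. F y)" by (intro card_mono) (auto simp: R_def F_def)
  also have "\<dots> \<le> (\<Sum>y\<in>R. card (F y))" by (rule card_UN_le) (auto simp: R_def)
  also have "\<dots> \<le> (\<Sum>y\<in>R. t)" by (intro sum_mono F_le)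
  also have "\<dots> = K ^ 2 * ch * t" by (simp add: R_def card_cartesian_product power2_eq_square)
  finally show ?thesis by (simp add: ch_def)
qed

text \<open>A non-edge density of \<open>a / 4\<close> in all large sets becomes a non-degree
  proportion of \<open>a / 16\<close> by averaging, which feeds the greedy independent sets and then
  the colouring by removal. The strict bound with \<open>real Q + 1\<close> allows \<open>Q\<close>
  to be the integer part of a real bound.\<close>

lemma ex_colouring_few_nonedges:
  fixes a :: real
  assumes a: "0 < a" "a \<le> 1" and t: "2 \<le> t" and j: "1 \<le> j" and S: "S \<subseteq> {..<n}"
    and many: "\<And>U. U \<subseteq> {..<n} \<Longrightarrow> t \<le> card U \<Longrightarrow>
        a / 4 * real (card U choose 2) < real (card {e. e \<subseteq> U \<and> card e = 2 \<and> \<not> b e})"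
    and Q: "real (card S) / real j + real t / (a / 16) ^ j < real Q + 1"
  shows "\<exists>g. proper_colouring (S, erdos_renyi_edges n b) Q g"
proof -
  let ?E = "erdos_renyi_edges n b"
  have finS: "finite S" using S finite_subset by blast
  have single: "{v} \<notin> ?E" for v by (simp add: erdos_renyi_edges_def all_edges_def)
  have deg: "\<exists>v\<in>U. a / 16 * real (card U) \<le> real (card {w\<in>U - {v}. {v, w} \<notin> ?E})"
    if "U \<subseteq> S" "real t \<le> real (card U)" for U
  proof -
    have U: "U \<subseteq> {..<n}" "finite U" "t \<le> card U" using that S finS finite_subset by auto
    have "{e. e \<subseteq> U \<and> card e = 2 \<and> \<not> b e} = {e. e \<subseteq> U \<and> card e = 2 \<and> e \<notin> ?E}"
      using U(1) by (auto simp: erdos_renyi_edges_def all_edges_def)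
    then have "a / 4 * real (card U choose 2) \<le> real (card {e. e \<subseteq> U \<and> card e = 2 \<and> e \<notin> ?E})"
      using many[OF U(1,3)] by simp
    from ex_large_nondegree[OF U(2) _ _ this] show ?thesis using t U(3) a by simp
  qed
  have "\<exists>I\<subseteq>U. card I = j \<and> (\<forall>u\<in>I. \<forall>v\<in>I. {u, v} \<notin> ?E)"
    if "U \<subseteq> S" "real t / (a / 16) ^ j \<le> real (card U)" for U
    using a by (intro indep_set_of_nondegree[OF finS _ _ _ single deg that]) auto
  then obtain k f where kf: "proper_colouring (S, ?E) k f"
      "real k \<le> real (card S) / real j + real t / (a / 16) ^ j"
    using colouring_of_indep_sets[OF finS, of j "real t / (a / 16) ^ j" ?E] single j a by fastforce
  then have "k \<le> Q" using Q by linarith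
  then have "proper_colouring (S, ?E) Q f" using kf(1) by (auto simp: proper_colouring_def)
  then show ?thesis by blast
qed

text \<open>The estimate for a single \<open>n\<close>, with all parameters free. The grid of side
  \<open>L\<close> serves the upper bound and needs cells of width comparable to \<open>r\<close>;
  the finer grid of side \<open>K\<close> serves the lower bound and needs cells of diameter at most
  \<open>r\<close>. The hypotheses on \<open>lo\<close> and \<open>hi\<close> leave the asymptotic
  comparison to the final proof.\<close>

lemma prob_chromatic_number_bounds:
  fixes a p r lo hi :: real and n t j L K :: nat
  defines "N \<equiv> real n * r\<^sup>2"
  assumes p: "0 < p" "p < 1" "a = min p (1 - p)" and n: "1 \<le> n" and t: "2 \<le> t"
    and t_large: "16 * ln (real n) \<le> a * (real t - 1)" and j: "1 \<le> j"
    and L: "1 \<le> L" "1 / real L \<le> 2 * r" "L = 1 \<or> even L \<and> r \<le> 1 / real L"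
    and K: "1 \<le> K" "2 / real K \<le> r"
    and lo: "\<And>ch. real n \<le> real K ^ 2 * real (ch :: nat) * real t \<Longrightarrow> lo \<le> real ch"
    and hi: "4 * (9 * N / real j + real t / (a / 16) ^ j) \<le> hi"
  shows "1 - real L ^ 2 * exp (- N) - 2 * (exp (1 / real n) - 1) \<le>
    measure (sample_space n p) {\<omega> \<in> space (sample_space n p).
       lo \<le> real (chromatic_number (random_graph n r \<omega>)) \<and> real (chromatic_number (random_graph n r \<omega>)) \<le> hi}"
    (is "_ \<le> measure _ ?G")
proof -
  let ?A = "\<Pi>\<^sub>M i\<in>{..<n}. uniform_measure lborel ({0..1} \<times> {0..1} :: (real \<times> real) set)"
  let ?B = "\<Pi>\<^sub>M e\<in>all_edges n. measure_pmf (bernoulli_pmf p)"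
  have a: "0 < a" "a \<le> 1" using p by auto
  have N: "0 \<le> N" by (simp add: N_def)
  \<comment> \<open>Cells of side at most \<open>2 * r\<close> have area at most
    \<open>4 * r^2\<close>, which is the factor 4 in the expected number of points.\<close>
  have "(1 / real L) ^ 2 \<le> (2 * r) ^ 2" using L by (intro power_mono) auto
  then have "real n * (1 / real L) ^ 2 \<le> real n * (2 * r) ^ 2" by (rule mult_left_mono) simp
  then have nL: "real n / real L ^ 2 \<le> 4 * N" by (simp add: N_def power_mult_distrib power_divide)
  obtain E where E: "E \<in> sets ?A" "measure ?A E \<le> real L ^ 2 * exp (- N)"
    "\<And>x i. x \<in> space ?A - E \<Longrightarrow> i < n \<Longrightarrow> x i \<in> {0..<1} \<times> {0..<1}"
    "\<And>x c. x \<in> space ?A - E \<Longrightarrow> c \<in> {..<L} \<times> {..<L} \<Longrightarrow> real (card {i\<in>{..<n}. x i \<in> torus_cell L c}) < 9 * N"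
    by (rule exceptional_set_points[OF L(1) nL]) blast
  obtain F where F: "F \<in> sets ?B" "measure ?B F \<le> 2 * (exp (1 / real n) - 1)"
    "\<And>b U \<beta>. b \<in> space ?B - F \<Longrightarrow> U \<subseteq> {..<n} \<Longrightarrow> t \<le> card U \<Longrightarrow>
       a / 4 * real (card U choose 2) < real (card {e. e \<subseteq> U \<and> card e = 2 \<and> b e = \<beta>})"
    by (rule exceptional_set_pairs[OF p n order_trans[OF one_le_numeral t] t_large]) blast
  have "1 - measure ?A E - measure ?B F \<le> measure (?A \<Otimes>\<^sub>M ?B) ?G"
  proof (rule measure_pair_cylinders)
    show "prob_space ?A" by (intro prob_space_PiM prob_space_unit_square)
    show "prob_space ?B" by (intro prob_space_PiM prob_space_measure_pmf)
    show "E \<in> sets ?A" "F \<in> sets ?B" by fact+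
    have "{\<omega> \<in> space (sample_space n p). (\<lambda>k. lo \<le> real k \<and> real k \<le> hi) (chromatic_number (random_graph n r \<omega>))}
       \<in> sets (sample_space n p)"
      using measurable_chromatic_number[of n r p] by measurable
    then show "?G \<in> sets (?A \<Otimes>\<^sub>M ?B)" by (simp add: sample_space_def)
    fix x b assume x: "x \<in> space ?A - E" and b: "b \<in> space ?B - F"
    define ch where "ch = chromatic_number (random_graph n r (x, b))"
    have xi: "x i \<in> {0..<1} \<times> {0..<1}" if "i < n" for i by (rule E(3)[OF x that])
    have "n \<le> K ^ 2 * ch * t" unfolding ch_def
    proof (rule card_le_chromatic_number_cells[OF K xi])
      fix U :: "nat set" assume U: "U \<subseteq> {..<n}" "t \<le> card U"
      have "0 \<le> a / 4 * real (card U choose 2)" using a by simp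
      with F(3)[OF b U, of True] have "card {e. e \<subseteq> U \<and> card e = 2 \<and> b e = True} \<noteq> 0" by linarith
      then have "{e. e \<subseteq> U \<and> card e = 2 \<and> b e = True} \<noteq> {}" by (metis card.empty)
      then show "\<exists>e\<subseteq>U. card e = 2 \<and> b e" by blast
    qed
    then have "real n \<le> real (K ^ 2 * ch * t)" by linarith
    then have lower: "lo \<le> real ch" by (intro lo) simp
    define T where "T = 9 * N / real j + real t / (a / 16) ^ j"
    have T: "0 \<le> T" using N a by (simp add: T_def)
    have "ch \<le> 4 * nat \<lfloor>T\<rfloor>" unfolding ch_def
    proof (rule chromatic_number_le_cells[OF L(1,3) xi])
      fix c assume c: "c \<in> {..<L} \<times> {..<L}"
      let ?S = "{i\<in>{..<n}. x i \<in> torus_cell L c}"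
      have "real (card ?S) / real j + real t / (a / 16) ^ j \<le> T"
        unfolding T_def using E(4)[OF x c] by (intro add_right_mono divide_right_mono) auto
      also have "T < real (nat \<lfloor>T\<rfloor>) + 1" using T by linarith
      finally have Q: "real (card ?S) / real j + real t / (a / 16) ^ j < real (nat \<lfloor>T\<rfloor>) + 1" .
      show "\<exists>g. proper_colouring (?S, erdos_renyi_edges n b) (nat \<lfloor>T\<rfloor>) g"
        by (rule ex_colouring_few_nonedges[OF a t j _ _ Q]) (use F(3)[OF b, of _ False] in auto)
    qed
    then have "real ch \<le> 4 * real (nat \<lfloor>T\<rfloor>)" by linarith
    also have "\<dots> \<le> 4 * T" using T by simp
    also have "\<dots> \<le> hi" using hi by (simp add: T_def)
    finally have "real ch \<le> hi" .
    then show "(x, b) \<in> ?G"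
      using lower x b by (simp add: sample_space_def space_pair_measure ch_def)
  qed
  then show ?thesis using E(2) F(2) by (simp add: sample_space_def)
qed

subsection \<open>Asymptotics\<close>

text \<open>Rounding \<open>y = 1 / (2 * r) \<ge> 1\<close> down and doubling gives an even
  \<open>L\<close> between \<open>y\<close> and \<open>2 * y\<close>, so the cell width lies between
  \<open>r\<close> and \<open>2 * r\<close>. For \<open>r > 1 / 2\<close> the whole torus is taken
  as one cell.\<close>

lemma ex_cell_grid:
  fixes r :: real
  assumes "0 < r"
  obtains L :: nat where "1 \<le> L" "1 / real L \<le> 2 * r" "L = 1 \<or> even L \<and> r \<le> 1 / real L"
proof (cases "r \<le> 1 / 2")
  case True
  define y where "y = 1 / (2 * r)"
  have y: "1 \<le> y" using True assms by (simp add: y_def)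
  define L where "L = 2 * nat \<lfloor>y\<rfloor>"
  have "real L = 2 * of_int \<lfloor>y\<rfloor>" using y by (simp add: L_def)
  moreover have "1 \<le> \<lfloor>y\<rfloor>" using y by simp
  ultimately have L: "real L \<le> 2 * y" "y \<le> real L" "2 \<le> real L" by linarith+
  show ?thesis
  proof
    show "1 \<le> L" using L(3) by linarith
    have "1 / real L \<le> 1 / y" using L y by (intro divide_left_mono) auto
    then show "1 / real L \<le> 2 * r" by (simp add: y_def)
    have "1 / (2 * y) \<le> 1 / real L" using L y by (intro divide_left_mono) auto
    then show "L = 1 \<or> even L \<and> r \<le> 1 / real L" using assms by (simp add: y_def L_def)
  qed
next
  case False
  then show ?thesis by (intro that[of 1]) auto
qed

text \<open>Ensures that the union bound over the cells costs at most a factor \<open>n\<close>,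
  which the factor \<open>exp (- N)\<close> absorbs.\<close>

lemma cell_grid_size:
  fixes r :: real and L n :: nat
  assumes "1 \<le> L" "L = 1 \<or> even L \<and> r \<le> 1 / real L" "1 \<le> n" "1 \<le> real n * r\<^sup>2" "0 \<le> r"
  shows "real L ^ 2 \<le> real n"
proof (cases "L = 1")
  case False
  then have "r \<le> 1 / real L" using assms by auto
  then have "real n * r\<^sup>2 \<le> real n * (1 / real L)\<^sup>2" using assms by (intro mult_left_mono power_mono) auto
  then have "1 \<le> real n / real L ^ 2" using assms(4) by (simp add: power_divide)
  then show ?thesis using assms(1) by (simp add: field_simps)
qed (use assms in auto)

theorem theorem5:
  fixes \<epsilon> p :: real and r :: "nat \<Rightarrow> real"
  assumes "0 < \<epsilon>" and "0 < p" and "p < 1"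
    and "\<And>n. 0 \<le> r n"
    and "r \<in> O(\<lambda>_. 1)"
    and "\<forall>\<^sub>F n in sequentially. real n * (r n)\<^sup>2 \<ge> real n powr \<epsilon>"
  shows "\<exists>c>0. \<exists>C>0.
    (\<lambda>n. measure (sample_space n p)
       {\<omega> \<in> space (sample_space n p).
          c * (real n * (r n)\<^sup>2 / log (1 / (1 - p)) (real n * (r n)\<^sup>2))
            \<le> real (chromatic_number (random_graph n (r n) \<omega>)) \<and>
          real (chromatic_number (random_graph n (r n) \<omega>))
            \<le> C * (real n * (r n)\<^sup>2 / log (1 / (1 - p)) (real n * (r n)\<^sup>2))})
     \<longlonglongrightarrow> 1"
proof -
  define N where "N = (\<lambda>n. real n * (r n)\<^sup>2)"
  define a where "a = min p (1 - p)"
  \<comment> \<open>One greedy step loses the factor \<open>a / 16 = exp (- h)\<close>;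
    \<open>D\<close> is the constant in \<open>t \<le> D * ln N\<close>; \<open>B\<close> converts
    the logarithm to base \<open>1 / (1 - p)\<close> into the natural one.\<close>
  define h where "h = ln (1 / (a / 16))"
  define D where "D = 16 / (a * \<epsilon>) + 3"
  define B where "B = ln (1 / (1 - p))"
  have a: "0 < a" "a \<le> 1" using assms(2,3) by (auto simp: a_def)
  have h: "0 < h" using a by (simp add: h_def)
  have D: "0 < D" using a assms(1) by (simp add: D_def add_pos_pos)
  have B: "0 < B" using assms(2,3) by (simp add: B_def)
  obtain R where R: "R > 0" "\<forall>\<^sub>F n in sequentially. r n \<le> R"
  proof -
    from assms(5) obtain R where "R > 0" "\<forall>\<^sub>F n in sequentially. norm (r n) \<le> R * norm (1::real)"
      by (elim landau_o.bigE)
    then show ?thesis by (intro that[of R]) (auto elim: eventually_mono)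
  qed
  \<comment> \<open>Boundedness of \<open>r\<close> enters the lower bound here: the fine grid has
    \<open>K \<le> 2 / r + 1 \<le> (2 + R) / r\<close>, so \<open>K^2 * t\<close> is at most
    \<open>(2 + R)^2 * D * ln N / r^2\<close>. The constant \<open>C\<close> collects the colours
    from removed independent sets, \<open>36 * h\<close>, and from the remaining vertices,
    \<open>1\<close>, times four parity classes.\<close>
  define c where "c = 1 / ((2 + R)\<^sup>2 * D * B)"
  define C where "C = 4 * (36 * h + 1) / B"
  have c: "0 < c" using R D B by (simp add: c_def)
  have C: "0 < C" using h B by (simp add: C_def add_pos_pos)
  have N_powr: "\<forall>\<^sub>F n in sequentially. real n powr \<epsilon> \<le> N n" using assms(6) by (simp add: N_def)
  have "filterlim (\<lambda>n. real n powr \<epsilon>) at_top sequentially" using assms(1) by real_asymp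
  then have N_top: "filterlim N at_top sequentially" using N_powr by (rule filterlim_at_top_mono)
  \<comment> \<open>The three conditions give \<open>ln N \<ge> 1\<close>, a positive greedy length
    \<open>j\<close>, and a leftover term of order \<open>ln N * sqrt N\<close> below
    \<open>N / ln N\<close>.\<close>
  have ev: "\<forall>\<^sub>F x :: real in at_top. exp 1 \<le> x \<and> 4 * h \<le> ln x \<and> D * ln x * sqrt x \<le> x / ln x"
  proof (intro eventually_conj)
    show "\<forall>\<^sub>F x in at_top. exp 1 \<le> (x :: real)" by (rule eventually_ge_at_top)
    show "\<forall>\<^sub>F x in at_top. 4 * h \<le> ln (x :: real)" by real_asymp
    show "\<forall>\<^sub>F x :: real in at_top. D * ln x * sqrt x \<le> x / ln x" using D by real_asymp
  qed
  have N_large: "\<forall>\<^sub>F n in sequentially. exp 1 \<le> N n \<and> 4 * h \<le> ln (N n) \<and> D * ln (N n) * sqrt (N n) \<le> N n / ln (N n)"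
    using eventually_compose_filterlim[OF ev N_top] .
  let ?G = "\<lambda>n. {\<omega> \<in> space (sample_space n p).
          c * (N n / log (1 / (1 - p)) (N n)) \<le> real (chromatic_number (random_graph n (r n) \<omega>)) \<and>
          real (chromatic_number (random_graph n (r n) \<omega>)) \<le> C * (N n / log (1 / (1 - p)) (N n))}"
  have lower: "\<forall>\<^sub>F n in sequentially.
      1 - real n * exp (- (real n powr \<epsilon>)) - 2 * (exp (1 / real n) - 1) \<le> measure (sample_space n p) (?G n)"
    using N_large N_powr R(2) eventually_ge_at_top[of 1]
  proof eventually_elim
    case (elim n)
    let ?N = "N n"
    have N: "exp 1 \<le> ?N" and lnN_h: "4 * h \<le> ln ?N" and sqrtN: "D * ln ?N * sqrt ?N \<le> ?N / ln ?N"
      and n: "1 \<le> n" using elim by auto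
    have "1 < exp (1 :: real)" by simp
    then have N1: "1 < ?N" using N by linarith
    have lnN: "1 \<le> ln ?N" using N by (simp add: ln_ge_iff N1 order.strict_trans[OF zero_less_one N1])
    have r: "0 < r n" using N1 assms(4)[of n] by (cases "r n = 0") (auto simp: N_def)
    have lnn: "ln (real n) \<le> ln ?N / \<epsilon>"
    proof -
      have "\<epsilon> * ln (real n) = ln (real n powr \<epsilon>)" using n by (simp add: ln_powr)
      also have "\<dots> \<le> ln ?N" using elim(2) n by (intro ln_mono) auto
      finally show ?thesis using assms(1) by (simp add: field_simps)
    qed
    \<comment> \<open>The ceiling in \<open>t\<close> meets the union bound over vertex sets, and
      the summand 2 gives \<open>2 \<le> t\<close> and room for \<open>real t - 1\<close>. The value
      of \<open>j\<close> is half of what would exhaust a cell: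
      \<open>(16 / a) ^ j = exp (h * j)\<close> is at most \<open>sqrt N\<close>.\<close>
    define t where "t = nat \<lceil>16 * ln (real n) / a\<rceil> + 2"
    define j where "j = nat \<lfloor>ln ?N / (2 * h)\<rfloor>"
    define K where "K = nat \<lceil>2 / r n\<rceil>"
    obtain L where L: "1 \<le> L" "1 / real L \<le> 2 * r n" "L = 1 \<or> even L \<and> r n \<le> 1 / real L"
      using ex_cell_grid[OF r] .
    have x0: "0 \<le> 16 * ln (real n) / a" using n a by simp
    have t_bounds: "16 * ln (real n) / a + 1 \<le> real t - 1" "real t \<le> 16 * ln (real n) / a + 3"
      unfolding t_def using x0 by linarith+
    have t_large: "16 * ln (real n) \<le> a * (real t - 1)"
    proof -
      have "16 * ln (real n) / a \<le> real t - 1" using t_bounds(1) by linarith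
      then show ?thesis using a(1) by (simp add: pos_divide_le_eq mult.commute)
    qed
    have t_D: "real t \<le> D * ln ?N"
    proof -
      have "16 * ln (real n) / a \<le> 16 * (ln ?N / \<epsilon>) / a" using lnn a by (intro divide_right_mono mult_left_mono) auto
      also have "\<dots> = 16 / (a * \<epsilon>) * ln ?N" by simp
      finally have "real t \<le> 16 / (a * \<epsilon>) * ln ?N + 3 * ln ?N" using t_bounds(2) lnN by linarith
      then show ?thesis by (simp add: D_def distrib_right)
    qed
    define y where "y = ln ?N / (2 * h)"
    have y: "2 \<le> y" using lnN_h h by (simp add: y_def pos_le_divide_eq)
    then have "real j = of_int \<lfloor>y\<rfloor>" by (simp add: j_def y_def[symmetric])
    \<comment> \<open>As \<open>y\<close> is at least 2, rounding down costs at most a factor 2;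
      this turns the \<open>9 * N\<close> points of a cell into the constant
      \<open>36 * h\<close>.\<close>
    then have "1 \<le> real j" and "y / 2 \<le> real j" and "real j \<le> y" using y by linarith+
    then have j_lo: "ln ?N / (2 * h) / 2 \<le> real j" and j_hi: "real j \<le> ln ?N / (2 * h)"
      by (simp_all add: y_def)
    have j: "1 \<le> j" using \<open>1 \<le> real j\<close> by simp
    have K: "1 \<le> K" "2 / real K \<le> r n" "real K \<le> (2 + R) / r n"
    proof -
      have pos: "0 < 2 / r n" using r by simp
      then have *: "2 / r n \<le> real K" "real K \<le> 2 / r n + 1" unfolding K_def by linarith+
      then have "0 < real K" using pos by linarith
      then show "1 \<le> K" by simp
      show "2 / real K \<le> r n" using *(1) r \<open>0 < real K\<close> by (simp add: field_simps)
      have "2 / r n + 1 \<le> 2 / r n + R / r n" using elim(3) r by (simp add: field_simps)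
      then show "real K \<le> (2 + R) / r n" using *(2) by (simp add: add_divide_distrib)
    qed
    have log_eq: "?N / log (1 / (1 - p)) ?N = B * (?N / ln ?N)" by (simp add: log_def B_def)
    have lo: "c * (?N / log (1 / (1 - p)) ?N) \<le> real k"
      if k: "real n \<le> real K ^ 2 * real k * real t" for k :: nat
    proof -
      have "real K ^ 2 * real k * real t \<le> ((2 + R) / r n) ^ 2 * real k * (D * ln ?N)"
        using K t_D by (intro mult_mono power_mono) auto
      then have "real n \<le> (2 + R) ^ 2 / (r n) ^ 2 * real k * (D * ln ?N)"
        using k by (simp add: power_divide)
      then have "?N \<le> (2 + R) ^ 2 * D * ln ?N * real k"
        using r by (simp add: N_def field_simps)
      moreover have "0 < (2 + R) ^ 2 * D * ln ?N" using R D lnN by simp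
      ultimately have "?N / ((2 + R) ^ 2 * D * ln ?N) \<le> real k" by (simp add: pos_divide_le_eq mult.commute)
      then show ?thesis using B by (simp add: log_eq c_def)
    qed
    have hi: "4 * (9 * ?N / real j + real t / (a / 16) ^ j) \<le> C * (?N / log (1 / (1 - p)) ?N)"
    proof -
      have "9 * ?N / real j \<le> 9 * ?N / (ln ?N / (2 * h) / 2)"
        using j j_lo N1 lnN h by (intro divide_left_mono mult_pos_pos) auto
      then have 1: "9 * ?N / real j \<le> 36 * h * (?N / ln ?N)" by (simp add: mult_ac)
      have "1 / (a / 16) ^ j = exp (h * real j)"
        using a by (simp add: h_def exp_of_nat2_mult power_divide)
      also have "\<dots> \<le> exp (ln ?N / 2)" using j_hi h by (simp add: field_simps)
      also have "\<dots> = sqrt ?N" using N1 by (simp add: powr_half_sqrt[symmetric] powr_def)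
      finally have "real t * (1 / (a / 16) ^ j) \<le> D * ln ?N * sqrt ?N"
        using t_D a by (intro mult_mono) (auto intro: order_trans[OF of_nat_0_le_iff])
      then have 2: "real t / (a / 16) ^ j \<le> ?N / ln ?N" using sqrtN by simp
      have "4 * (9 * ?N / real j + real t / (a / 16) ^ j) \<le> 4 * (36 * h + 1) * (?N / ln ?N)"
        using 1 2 by argo
      also have "\<dots> = C * (?N / log (1 / (1 - p)) ?N)" using B by (simp add: C_def log_eq)
      finally show ?thesis .
    qed
    have "1 - real L ^ 2 * exp (- ?N) - 2 * (exp (1 / real n) - 1) \<le> measure (sample_space n p) (?G n)"
      using lo hi unfolding N_def
      by (intro prob_chromatic_number_bounds[OF assms(2,3) a_def n _ t_large j L K(1,2)])
         (auto simp: t_def)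
    moreover have "real L ^ 2 * exp (- ?N) \<le> real n * exp (- (real n powr \<epsilon>))"
      using cell_grid_size[OF L(1,3) n] N1 assms(4) elim(2) by (intro mult_mono) (auto simp: N_def)
    ultimately show ?case by linarith
  qed
  have "(\<lambda>n. measure (sample_space n p) (?G n)) \<longlonglongrightarrow> 1"
  proof (rule tendsto_sandwich[OF lower])
    show "\<forall>\<^sub>F n in sequentially. measure (sample_space n p) (?G n) \<le> 1"
      using prob_space.prob_le_1[OF prob_space_sample_space] by (intro always_eventually) auto
    \<comment> \<open>Here \<open>exp (- (n powr \<epsilon>))\<close> outweighs the number of cells,
      for any positive \<epsilon>.\<close>
    have 1: "(\<lambda>n. real n * exp (- (real n powr \<epsilon>))) \<longlonglongrightarrow> 0" using assms(1) by real_asymp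
    have 2: "(\<lambda>n. 2 * (exp (1 / real n) - 1)) \<longlonglongrightarrow> 0" by real_asymp
    show "(\<lambda>n. 1 - real n * exp (- (real n powr \<epsilon>)) - 2 * (exp (1 / real n) - 1)) \<longlonglongrightarrow> 1"
      using tendsto_diff[OF tendsto_diff[OF tendsto_const[of 1] 1] 2] by simp
  qed simp
  then show ?thesis unfolding N_def using c C by blast
qed

end
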